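(* Let $N>2$ be an integer and let $\alpha_N=\alpha\!\left(e^{-\pi\sqrt{N}}\right)$. Then $$\frac{1}{\sqrt{N}\,\pi}=\sum_{k=0}^\infty \frac{\left(\frac{1}{2}\right)_k^3}{(k!)^3} \left(k\left(1-2\alpha_N\right)-\frac{2}{\sqrt{N}}\,D_N\!\left(e^{-\pi/\sqrt{N}}\right)\right) \left(4\alpha_N(1-\alpha_N)\right)^k.$$
   Context: For $0<|q|<1$ let $\vartheta_2(q)=\sum_{k\in\mathbb Z}q^{(k+1/2)^2}$, $\vartheta_3(q)=\sum_{k\in\mathbb Z}q^{k^2}$, and $\alpha(q)=\vartheta_2^4(q)/\vartheta_3^4(q)$. For a positive integer $\ell$ define $$D_\ell(q)=\frac{1}{\vartheta_3^3(q)\vartheta_3^3(q^\ell)}\det\begin{pmatrix}\vartheta_3(q)&\vartheta_3(q^\ell)\\ q\frac{d\vartheta_3(q)}{dq}& q\frac{d\vartheta_3(q^\ell)}{dq}\end{pmatrix}.$$ $(a)_k=a(a+1)\cdots(a+k-1)$ denotes the Pochhammer symbol. *)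

theory Defs
  imports "HOL-Analysis.Analysis"
begin

text \<open>
  The nome \<open>q\<close> ranges over the complex numbers with \<open>0 < \<bar>q\<bar> < 1\<close>, where both theta series
  converge absolutely. The fractional powers in \<open>theta2\<close> use the principal branch; replacing it
  by another branch multiplies \<open>theta2\<close> by a fourth root of unity, which does not affect
  \<open>theta_alpha\<close>.
\<close>

definition theta2 :: "complex \<Rightarrow> complex" where
  "theta2 q = (\<Sum>\<^sub>\<infinity>k::int. q powr ((of_int k + 1 / 2)\<^sup>2))"

definition theta3 :: "complex \<Rightarrow> complex" where
  "theta3 q = (\<Sum>\<^sub>\<infinity>k::int. q powi (k\<^sup>2))"

definition theta_alpha :: "complex \<Rightarrow> complex" where
  "theta_alpha q = theta2 q ^ 4 / theta3 q ^ 4"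

definition theta_D :: "nat \<Rightarrow> complex \<Rightarrow> complex" where
  "theta_D l q =
     1 / (theta3 q ^ 3 * theta3 (q ^ l) ^ 3) *
     det (vector [vector [theta3 q, theta3 (q ^ l)],
                  vector [q * deriv theta3 q, q * deriv (\<lambda>z. theta3 (z ^ l)) q]]
          :: complex ^ 2 ^ 2)"

end

theory Submission
  imports Defs "HOL-Complex_Analysis.Complex_Analysis" "HOL-Probability.Probability"
begin

text \<open>
  Write \<open>\<alpha>\<close> for the modulus, \<open>z = theta3\<^sup>2\<close>, \<open>w = 1 / z\<close> and \<open>\<delta> = q d/dq\<close>. Splitting the lattice of pairs
  of integers by parity relates the theta functions at \<open>q\<close> and \<open>q\<^sup>2\<close>. The quantities
  \<open>\<delta>\<alpha> / (\<alpha> (1 - \<alpha>) z\<^sup>2) - 1\<close> and \<open>z \<delta>\<^sup>2w + \<alpha> (1 - \<alpha>) z\<^sup>4 / 4\<close> are holomorphic near \<open>0\<close>, vanish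
  at \<open>0\<close>, and get multiplied by \<open>1\<close> and \<open>1 / 4\<close>, respectively, under \<open>q \<mapsto> q\<^sup>2\<close>; hence both are zero.
  With \<open>X = 4 \<alpha> (1 - \<alpha>)\<close> and \<open>H\<close> the hypergeometric series with coefficients \<open>((1/2)\<^sub>k / k!)\<^sup>3\<close>, the
  third-order differential equation of \<open>H\<close> becomes \<open>\<delta>\<^sup>3 (H(X) w\<^sup>2) = 0\<close>, so \<open>H(X) w\<^sup>2\<close> is constant,
  that is, \<open>H(X) = theta3\<^sup>4\<close>. Differentiating this once gives the part of the series with the factor
  \<open>k\<close> in terms of \<open>\<delta> theta3\<close>. The inversion formula for \<open>theta3\<close> under
  \<open>t \<mapsto> 1 / t\<close>, \<open>q = exp (- \<pi> t)\<close>, and its derivative at \<open>t = sqrt N\<close> evaluate \<open>theta_D\<close>, and the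
  derivatives cancel. All of this only needs \<open>\<bar>q\<bar> < 1 / 100\<close>, because \<open>exp (- \<pi> sqrt 3) < 1 / 100\<close>.
\<close>

subsection \<open>Theta series and their duplication formulas\<close>

lemma has_sum_int_split:
  fixes f :: "int \<Rightarrow> 'a::{topological_comm_monoid_add}"
  assumes "((\<lambda>n. f (int n)) has_sum a) UNIV" "((\<lambda>n. f (- 1 - int n)) has_sum b) UNIV"
  shows "(f has_sum (a + b)) UNIV"
proof -
  have "(f has_sum a) {0..}"
    by (rule has_sum_reindex_bij_witness[where i = nat and j = int, THEN iffD1, rotated -1, OF assms(1)]) auto
  moreover have "(f has_sum b) {..<0}"
    by (rule has_sum_reindex_bij_witness[where i = "\<lambda>k. nat (- 1 - k)" and j = "\<lambda>n. - 1 - int n", THEN iffD1, rotated -1, OF assms(2)]) auto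
  ultimately have "(f has_sum (a + b)) ({0..} \<union> {..<0})"
    by (rule has_sum_Un_disjoint) auto
  moreover have "{0..} \<union> {..<0} = (UNIV :: int set)" by auto
  ultimately show ?thesis by simp
qed

lemma summable_on_int_split:
  fixes f :: "int \<Rightarrow> 'a::{topological_comm_monoid_add}"
  assumes "(\<lambda>n. f (int n)) summable_on UNIV" "(\<lambda>n. f (- 1 - int n)) summable_on UNIV"
  shows "f summable_on UNIV"
  using assms has_sum_int_split unfolding summable_on_def by blast

text \<open>A common majorant for the integer-indexed series below. The exponent is |k| - 1 instead
  of |k| because \<open>k * (k + 1)\<close> already vanishes at k = -1, and in the Gaussian sums x +
  n can vanish for n = -1 and x in the unit interval. At k = 0 the truncation by \<open>nat\<close>
  gives the value 1.\<close>

lemma summable_on_int_geometric: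
  fixes r :: real
  assumes "0 \<le> r" "r < 1"
  shows "(\<lambda>k::int. r ^ nat (\<bar>k\<bar> - 1)) summable_on UNIV"
proof (rule summable_on_int_split)
  have "summable (\<lambda>n. r ^ n)" using assms by (simp add: summable_geometric)
  then have "summable (\<lambda>n. r ^ (n - 1))"
    by (subst summable_iff_shift[symmetric, of _ 1]) simp
  then show "(\<lambda>n. r ^ nat (\<bar>int n\<bar> - 1)) summable_on UNIV"
    using assms by (subst summable_on_UNIV_nonneg_real_iff) (auto simp: nat_diff_distrib')
  show "(\<lambda>n. r ^ nat (\<bar>- 1 - int n\<bar> - 1)) summable_on UNIV"
    using assms \<open>summable (\<lambda>n. r ^ n)\<close>
    by (subst summable_on_UNIV_nonneg_real_iff) (auto simp: nat_diff_distrib)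
qed

lemma norm_powi_le_geometric:
  fixes q :: complex
  assumes "0 \<le> e" "\<bar>k\<bar> \<le> e + 1" "norm q \<le> r" "r \<le> 1"
  shows "norm (q powi e) \<le> r ^ nat (\<bar>k\<bar> - 1)"
proof -
  have "norm (q powi e) = norm q ^ nat e"
    using assms(1) by (simp add: power_int_def norm_power)
  also have "\<dots> \<le> norm q ^ nat (\<bar>k\<bar> - 1)"
    using assms by (intro power_decreasing) auto
  also have "\<dots> \<le> r ^ nat (\<bar>k\<bar> - 1)"
    using assms by (intro power_mono) auto
  finally show ?thesis .
qed

lemma lacunary_abs_summable:
  fixes e :: "int \<Rightarrow> int" and q :: complex
  assumes "\<And>k. 0 \<le> e k" "\<And>k. \<bar>k\<bar> \<le> e k + 1" "norm q < 1"
  shows "(\<lambda>k. norm (q powi e k)) summable_on UNIV"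
  using assms summable_on_int_geometric[of "norm q"]
  by (intro Infinite_Sum.abs_summable_on_comparison_test'[where g = "\<lambda>k::int. norm q ^ nat (\<bar>k\<bar> - 1)"])
     (auto intro: norm_powi_le_geometric)

text \<open>The finite partial sums are polynomials in q. The geometric majorant makes them converge
  uniformly on every closed disc of radius r < 1, and these discs exhaust the unit disc.\<close>

lemma lacunary_holomorphic:
  fixes e :: "int \<Rightarrow> int"
  assumes e: "\<And>k. 0 \<le> e k" "\<And>k. \<bar>k\<bar> \<le> e k + 1"
  shows "(\<lambda>q::complex. \<Sum>\<^sub>\<infinity>k. q powi e k) holomorphic_on ball 0 1"
proof -
  have hol: "(\<lambda>q::complex. \<Sum>\<^sub>\<infinity>k. q powi e k) holomorphic_on ball 0 r" if "0 < r" "r < 1" for r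
  proof (rule holomorphic_uniform_limit)
    show "uniform_limit (cball 0 r) (\<lambda>X q. \<Sum>k\<in>X. q powi e k)
            (\<lambda>q::complex. \<Sum>\<^sub>\<infinity>k. q powi e k) (finite_subsets_at_top UNIV)"
      using that e by (intro Weierstrass_m_test_general[OF _ summable_on_int_geometric[of r]] norm_powi_le_geometric) auto
    show "\<forall>\<^sub>F X in finite_subsets_at_top UNIV. continuous_on (cball 0 r) (\<lambda>q::complex. \<Sum>k\<in>X. q powi e k)
            \<and> (\<lambda>q. \<Sum>k\<in>X. q powi e k) holomorphic_on ball 0 r"
      using e by (intro always_eventually allI conjI) (auto simp: power_int_def intro!: continuous_intros holomorphic_intros)
  qed auto
  show ?thesis
    unfolding holomorphic_on_def
  proof
    fix q :: complex assume "q \<in> ball 0 1"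
    then obtain r where r: "norm q < r" "r < 1" using dense by auto
    have "0 < r" using r(1) norm_ge_zero[of q] by linarith
    have "(\<lambda>q::complex. \<Sum>\<^sub>\<infinity>k. q powi e k) field_differentiable at q"
      using hol[OF \<open>0 < r\<close> r(2)] r by (auto simp: holomorphic_on_open field_differentiable_def)
    then show "(\<lambda>q::complex. \<Sum>\<^sub>\<infinity>k. q powi e k) field_differentiable at q within ball 0 1"
      by (rule field_differentiable_at_within)
  qed
qed

text \<open>Dividing out \<open>q\<^sup>1\<^sup>/\<^sup>4\<close> from \<open>theta2\<close> leaves a function that is holomorphic in the whole disc.\<close>

definition theta_psi :: "complex \<Rightarrow> complex" where
  "theta_psi q = (\<Sum>\<^sub>\<infinity>k::int. q powi (k * (k + 1)))"

lemma abs_le_square_int: "\<bar>k\<bar> \<le> k\<^sup>2" for k :: int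
  using mult_left_mono[of 1 "\<bar>k\<bar>" "\<bar>k\<bar>"]
  by (cases "k = 0") (auto simp: power2_eq_square simp flip: abs_mult)

lemma pronic_nonneg: "0 \<le> k * (k + 1)" for k :: int
  by (cases "k \<ge> 0") (auto intro: mult_nonneg_nonneg mult_nonpos_nonpos)

lemma abs_le_pronic: "\<bar>k\<bar> \<le> k * (k + 1) + 1" for k :: int
proof (cases "k \<ge> 0")
  case True then show ?thesis by (simp add: algebra_simps)
next
  case False
  then have "(- 1 - k) * 1 \<le> (-1 - k) * (- k)" by (intro mult_left_mono) auto
  with False show ?thesis by (simp add: algebra_simps)
qed

lemma theta3_abs_summable: "norm q < 1 \<Longrightarrow> (\<lambda>k. norm (q powi k\<^sup>2)) summable_on UNIV" for q :: complex
  using abs_le_square_int by (intro lacunary_abs_summable) (auto simp: add_increasing2)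

lemma theta_psi_abs_summable: "norm q < 1 \<Longrightarrow> (\<lambda>k. norm (q powi (k * (k + 1)))) summable_on UNIV" for q :: complex
  by (intro lacunary_abs_summable pronic_nonneg abs_le_pronic)

lemma theta3_holomorphic: "theta3 holomorphic_on ball 0 1"
  using abs_le_square_int unfolding theta3_def by (intro lacunary_holomorphic) (auto simp: add_increasing2)

lemma theta_psi_holomorphic: "theta_psi holomorphic_on ball 0 1"
  unfolding theta_psi_def by (intro lacunary_holomorphic pronic_nonneg abs_le_pronic)

lemma lacunary_tail_bound:
  fixes q :: complex and e :: "nat \<Rightarrow> nat"
  assumes "norm q < 1" "\<And>n. n + m \<le> e n"
  shows "(\<lambda>n. q ^ e n) summable_on UNIV"
    and "norm (\<Sum>\<^sub>\<infinity>n. q ^ e n) \<le> norm q ^ m / (1 - norm q)"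
proof -
  have "(\<lambda>n. norm q ^ n * norm q ^ m) sums (1 / (1 - norm q) * norm q ^ m)"
    using assms(1) by (intro sums_mult2 geometric_sums) auto
  then have g: "((\<lambda>n. norm q ^ (n + m)) has_sum (norm q ^ m / (1 - norm q))) UNIV"
    by (intro norm_summable_imp_has_sum) (auto simp: power_add norm_mult norm_power sums_iff)
  have le: "norm (q ^ e n) \<le> norm q ^ (n + m)" for n
    using assms by (auto simp: norm_power intro!: power_decreasing)
  have "(\<lambda>n. norm (q ^ e n)) summable_on UNIV"
    by (rule Infinite_Sum.abs_summable_on_comparison_test'[OF has_sum_imp_summable[OF g]]) (use le in auto)
  then show s: "(\<lambda>n. q ^ e n) summable_on UNIV" by (rule abs_summable_summable)
  show "norm (\<Sum>\<^sub>\<infinity>n. q ^ e n) \<le> norm q ^ m / (1 - norm q)"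
    by (rule norm_infsum_le[OF has_sum_infsum[OF s] g]) (use le in auto)
qed

text \<open>Dropping the constant term 1 leaves the exponents \<open>e (Suc n)\<close>, which are at
  least n + 1, so the tail bound applies with m = 1.\<close>

lemma lacunary_bound:
  fixes q :: complex and e :: "nat \<Rightarrow> nat"
  assumes "norm q < 1" "e 0 = 0" "\<And>n. n \<le> e n"
  shows "norm ((\<Sum>\<^sub>\<infinity>n. q ^ e n) - 1) \<le> norm q / (1 - norm q)"
proof -
  have s: "(\<lambda>n. q ^ e n) summable_on UNIV"
    using lacunary_tail_bound(1)[OF assms(1), of 0 e] assms by auto
  have "(\<lambda>n. q ^ e n) sums (\<Sum>\<^sub>\<infinity>n. q ^ e n)"
    using has_sum_infsum[OF s] by (rule has_sum_imp_sums)
  then have 1: "(\<lambda>n. q ^ e (Suc n)) sums ((\<Sum>\<^sub>\<infinity>n. q ^ e n) - 1)"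
    by (subst sums_Suc_iff) (simp add: assms)
  have *: "n + 1 \<le> e (Suc n)" for n using assms(3)[of "Suc n"] by simp
  have "(\<lambda>n. q ^ e (Suc n)) sums (\<Sum>\<^sub>\<infinity>n. q ^ e (Suc n))"
    using has_sum_infsum[OF lacunary_tail_bound(1)[OF assms(1) *]] by (rule has_sum_imp_sums)
  with 1 have "(\<Sum>\<^sub>\<infinity>n. q ^ e n) - 1 = (\<Sum>\<^sub>\<infinity>n. q ^ e (Suc n))" by (rule sums_unique2)
  with lacunary_tail_bound(2)[OF assms(1) *] show ?thesis by simp
qed

lemma theta3_bound:
  assumes "norm q < 1"
  shows "norm (theta3 q - 1) \<le> 2 * norm q / (1 - norm q)"
proof -
  have le: "n \<le> n\<^sup>2" "n + 1 \<le> (Suc n)\<^sup>2" for n :: nat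
    by (auto simp: power2_eq_square)
  have "((\<lambda>k::int. q powi k\<^sup>2) has_sum ((\<Sum>\<^sub>\<infinity>n. q ^ n\<^sup>2) + (\<Sum>\<^sub>\<infinity>n. q ^ (Suc n)\<^sup>2))) UNIV"
  proof (rule has_sum_int_split)
    have "((\<lambda>n. q ^ n\<^sup>2) has_sum (\<Sum>\<^sub>\<infinity>n. q ^ n\<^sup>2)) UNIV"
      using lacunary_tail_bound(1)[OF assms, of 0 "\<lambda>n. n\<^sup>2"] le by (intro has_sum_infsum) auto
    then show "((\<lambda>n. q powi (int n)\<^sup>2) has_sum (\<Sum>\<^sub>\<infinity>n. q ^ n\<^sup>2)) UNIV"
      by (simp add: power_int_def nat_power_eq)
    have "((\<lambda>n. q ^ (Suc n)\<^sup>2) has_sum (\<Sum>\<^sub>\<infinity>n. q ^ (Suc n)\<^sup>2)) UNIV"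
      using lacunary_tail_bound(1)[OF assms, of 1 "\<lambda>n. (Suc n)\<^sup>2"] le by (intro has_sum_infsum) auto
    moreover have "(- 1 - int n)\<^sup>2 = int ((Suc n)\<^sup>2)" for n by (simp add: power2_eq_square algebra_simps)
    ultimately show "((\<lambda>n. q powi (- 1 - int n)\<^sup>2) has_sum (\<Sum>\<^sub>\<infinity>n. q ^ (Suc n)\<^sup>2)) UNIV"
      by (simp only: power_int_of_nat)
  qed
  then have "theta3 q - 1 = ((\<Sum>\<^sub>\<infinity>n. q ^ n\<^sup>2) - 1) + (\<Sum>\<^sub>\<infinity>n. q ^ (Suc n)\<^sup>2)"
    unfolding theta3_def by (simp add: infsumI)
  also have "norm \<dots> \<le> norm q / (1 - norm q) + norm q ^ 1 / (1 - norm q)"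
    using assms le lacunary_bound[of q "\<lambda>n. n\<^sup>2"] lacunary_tail_bound(2)[of q 1 "\<lambda>n. (Suc n)\<^sup>2"]
    by (intro norm_triangle_mono) auto
  finally show ?thesis by simp
qed

text \<open>The reflection k -> -1 - k preserves \<open>k * (k + 1)\<close> and swaps negative with
  nonnegative indices. The series is therefore twice its nonnegative half, whose constant term is
  1.\<close>

lemma theta_psi_bound:
  assumes "norm q < 1"
  shows "norm (theta_psi q - 2) \<le> 2 * norm q / (1 - norm q)"
proof -
  have 1: "((\<lambda>n. q ^ (n * (n + 1))) has_sum (\<Sum>\<^sub>\<infinity>n. q ^ (n * (n + 1)))) UNIV"
    using lacunary_tail_bound(1)[OF assms, of 0 "\<lambda>n. n * (n + 1)"] by (intro has_sum_infsum) auto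
  have "((\<lambda>k::int. q powi (k * (k + 1))) has_sum ((\<Sum>\<^sub>\<infinity>n. q ^ (n * (n + 1))) + (\<Sum>\<^sub>\<infinity>n. q ^ (n * (n + 1))))) UNIV"
  proof (rule has_sum_int_split)
    have "int n * (int n + 1) = int (n * (n + 1))" "(- 1 - int n) * (- 1 - int n + 1) = int (n * (n + 1))" for n
      by (simp_all add: algebra_simps)
    then show "((\<lambda>n. q powi (int n * (int n + 1))) has_sum (\<Sum>\<^sub>\<infinity>n. q ^ (n * (n + 1)))) UNIV"
      "((\<lambda>n. q powi ((- 1 - int n) * (- 1 - int n + 1))) has_sum (\<Sum>\<^sub>\<infinity>n. q ^ (n * (n + 1)))) UNIV"
      using 1 by (simp_all only: power_int_of_nat)
  qed
  then have "theta_psi q - 2 = 2 * ((\<Sum>\<^sub>\<infinity>n. q ^ (n * (n + 1))) - 1)"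
    unfolding theta_psi_def by (simp add: infsumI)
  then have "norm (theta_psi q - 2) = 2 * norm ((\<Sum>\<^sub>\<infinity>n. q ^ (n * (n + 1))) - 1)"
    by (simp only: norm_mult norm_numeral)
  then show ?thesis
    using lacunary_bound[of q "\<lambda>n. n * (n + 1)"] assms by simp
qed

section \<open>Duplication formulas from double series\<close>

lemma has_sum_product:
  fixes f :: "'a \<Rightarrow> complex" and g :: "'b \<Rightarrow> complex"
  assumes f: "(\<lambda>x. norm (f x)) summable_on A" and g: "(\<lambda>x. norm (g x)) summable_on B"
  shows "((\<lambda>(x, y). f x * g y) has_sum (infsum f A * infsum g B)) (A \<times> B)"
proof (rule has_sum_SigmaI)
  have "(\<lambda>(x, y). norm (f x) * norm (g y)) summable_on A \<times> B"
  proof (rule summable_on_SigmaI)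
    show "((\<lambda>y. case (x, y) of (x, y) \<Rightarrow> norm (f x) * norm (g y)) has_sum norm (f x) * infsum (\<lambda>y. norm (g y)) B) B" for x
      using g by (auto intro!: has_sum_cmult_right has_sum_infsum)
    show "(\<lambda>x. norm (f x) * infsum (\<lambda>y. norm (g y)) B) summable_on A"
      using f by (rule summable_on_cmult_left)
  qed auto
  then have "(\<lambda>p. norm (case p of (x, y) \<Rightarrow> f x * g y)) summable_on A \<times> B"
    by (simp add: case_prod_unfold norm_mult)
  then show "(\<lambda>(x, y). f x * g y) summable_on A \<times> B" by (rule abs_summable_summable)
  show "((\<lambda>y. case (x, y) of (x, y) \<Rightarrow> f x * g y) has_sum f x * infsum g B) B" for x
    using g by (auto intro!: has_sum_cmult_right has_sum_infsum abs_summable_summable)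
  show "((\<lambda>x. f x * infsum g B) has_sum infsum f A * infsum g B) A"
    using f by (auto intro!: has_sum_cmult_left has_sum_infsum abs_summable_summable)
qed

text \<open>The maps (m, n) -> (m + n, m - n) and (m, n) -> (m + n + 1, m - n) are bijections onto
  the pairs with even and odd sum. They turn a sum of two squares into twice such a sum, which is
  how q is replaced by its square.\<close>

lemma has_sum_parity_split:
  fixes f :: "int \<times> int \<Rightarrow> 'a::topological_comm_monoid_add"
  assumes "((\<lambda>(m, n). f (m + n, m - n)) has_sum a) UNIV"
    and "((\<lambda>(m, n). f (m + n + 1, m - n)) has_sum b) UNIV"
  shows "(f has_sum (a + b)) UNIV"
proof -
  have "(f has_sum a) {(x, y). even (x + y)}"
    by (rule has_sum_reindex_bij_witness[where i = "\<lambda>(x, y). ((x + y) div 2, (x - y) div 2)" and j = "\<lambda>(m, n). (m + n, m - n)", THEN iffD1, rotated -1, OF assms(1)]) 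
       (auto, presburger+)
  moreover have "(f has_sum b) {(x, y). odd (x + y)}"
    by (rule has_sum_reindex_bij_witness[where i = "\<lambda>(x, y). ((x + y - 1) div 2, (x - y - 1) div 2)" and j = "\<lambda>(m, n). (m + n + 1, m - n)", THEN iffD1, rotated -1, OF assms(2)]) 
       (auto, presburger+)
  ultimately have "(f has_sum (a + b)) ({(x, y). even (x + y)} \<union> {(x, y). odd (x + y)})"
    by (rule has_sum_Un_disjoint) auto
  moreover have "{(x, y). even (x + y)} \<union> {(x, y). odd (x + y)} = (UNIV :: (int \<times> int) set)" by auto
  ultimately show ?thesis by simp
qed

text \<open>Nonnegative exponents keep the rule valid at q = 0, where the functional equations below
  are anchored.\<close>

lemma powi_mult_nonneg: "0 \<le> a \<Longrightarrow> 0 \<le> b \<Longrightarrow> q powi a * q powi b = q powi (a + b)" for q :: complex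
  by (simp add: power_int_def nat_add_distrib power_add)

lemma powi_square_nonneg: "0 \<le> a \<Longrightarrow> (q\<^sup>2) powi a = q powi (2 * a)" for q :: complex
  by (simp add: power_int_def nat_mult_distrib power_mult)

text \<open>In the double series of the square, the even class has exponents 2 (m^2 + n^2) and the
  odd class 1 + 2 m (m + 1) + 2 n (n + 1), so both parts factor again.\<close>

lemma theta3_square:
  assumes "norm q < 1"
  shows "(theta3 q)\<^sup>2 = (theta3 (q\<^sup>2))\<^sup>2 + q * (theta_psi (q\<^sup>2))\<^sup>2"
proof -
  have q2: "norm (q\<^sup>2) < 1" using assms by (simp add: norm_power power_less_one_iff)
  let ?f = "\<lambda>(x::int, y::int). q powi x\<^sup>2 * q powi y\<^sup>2"
  have "(?f has_sum (theta3 q)\<^sup>2) UNIV"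
    using has_sum_product[OF theta3_abs_summable theta3_abs_summable, of q q] assms
    by (simp add: theta3_def power2_eq_square)
  moreover have "(?f has_sum ((theta3 (q\<^sup>2))\<^sup>2 + q * (theta_psi (q\<^sup>2))\<^sup>2)) UNIV"
  proof (rule has_sum_parity_split)
    have "?f (m + n, m - n) = (q\<^sup>2) powi m\<^sup>2 * (q\<^sup>2) powi n\<^sup>2" for m n
      by (simp add: powi_mult_nonneg powi_square_nonneg) (simp add: power2_eq_square algebra_simps)
    then show "((\<lambda>(m, n). ?f (m + n, m - n)) has_sum (theta3 (q\<^sup>2))\<^sup>2) UNIV"
      using has_sum_product[OF theta3_abs_summable theta3_abs_summable, OF q2 q2]
      by (simp add: theta3_def power2_eq_square)
    have "?f (m + n + 1, m - n) = q * ((q\<^sup>2) powi (m * (m + 1)) * (q\<^sup>2) powi (n * (n + 1)))" for m n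
    proof -
      have "q * ((q\<^sup>2) powi (m * (m + 1)) * (q\<^sup>2) powi (n * (n + 1)))
          = q powi 1 * (q powi (2 * (m * (m + 1))) * q powi (2 * (n * (n + 1))))"
        by (simp only: powi_square_nonneg pronic_nonneg power_int_1_right)
      also have "\<dots> = q powi (1 + (2 * (m * (m + 1)) + 2 * (n * (n + 1))))"
        using pronic_nonneg[of m] pronic_nonneg[of n] by (simp only: powi_mult_nonneg add_nonneg_nonneg zero_le_one mult_nonneg_nonneg zero_le_numeral)
      also have "1 + (2 * (m * (m + 1)) + 2 * (n * (n + 1))) = (m + n + 1)\<^sup>2 + (m - n)\<^sup>2"
        by (simp add: power2_eq_square algebra_simps)
      finally show ?thesis by (simp add: powi_mult_nonneg)
    qed
    then show "((\<lambda>(m, n). ?f (m + n + 1, m - n)) has_sum (q * (theta_psi (q\<^sup>2))\<^sup>2)) UNIV"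
      using has_sum_cmult_right[OF has_sum_product[OF theta_psi_abs_summable theta_psi_abs_summable, OF q2 q2], of q]
      by (simp add: theta_psi_def power2_eq_square case_prod_unfold)
  qed
  ultimately show ?thesis by (rule has_sum_unique)
qed

text \<open>For the exponent x (x + 1) + y (y + 1) the even class gives 2 m (m + 1) + 2 n^2 and the
  odd class 2 n (n + 1) + 2 (m + 1)^2. Both yield the same product, hence the factor 2.\<close>

lemma theta_psi_square:
  assumes "norm q < 1"
  shows "(theta_psi q)\<^sup>2 = 2 * theta_psi (q\<^sup>2) * theta3 (q\<^sup>2)"
proof -
  have q2: "norm (q\<^sup>2) < 1" using assms by (simp add: norm_power power_less_one_iff)
  let ?f = "\<lambda>(x::int, y::int). q powi (x * (x + 1)) * q powi (y * (y + 1))"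
  have P: "((\<lambda>(m, n). (q\<^sup>2) powi (m * (m + 1)) * (q\<^sup>2) powi n\<^sup>2) has_sum (theta_psi (q\<^sup>2) * theta3 (q\<^sup>2))) UNIV"
    using has_sum_product[OF theta_psi_abs_summable theta3_abs_summable, OF q2 q2]
    by (simp add: theta_psi_def theta3_def)
  have e: "q powi a * q powi b = (q\<^sup>2) powi c * (q\<^sup>2) powi d" if "a + b = 2 * c + 2 * d" "0 \<le> a" "0 \<le> b" "0 \<le> c" "0 \<le> d" for a b c d
    using that by (simp add: powi_square_nonneg powi_mult_nonneg)
  have "(?f has_sum (theta_psi q)\<^sup>2) UNIV"
    using has_sum_product[OF theta_psi_abs_summable theta_psi_abs_summable, of q q] assms
    by (simp add: theta_psi_def power2_eq_square)
  moreover have "(?f has_sum (theta_psi (q\<^sup>2) * theta3 (q\<^sup>2) + theta_psi (q\<^sup>2) * theta3 (q\<^sup>2))) UNIV"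
  proof (rule has_sum_parity_split)
    have "?f (m + n, m - n) = (q\<^sup>2) powi (m * (m + 1)) * (q\<^sup>2) powi n\<^sup>2" for m n
      unfolding prod.case by (rule e[OF _ pronic_nonneg pronic_nonneg pronic_nonneg zero_le_power2]) (simp add: power2_eq_square algebra_simps)
    with P show "((\<lambda>(m, n). ?f (m + n, m - n)) has_sum (theta_psi (q\<^sup>2) * theta3 (q\<^sup>2))) UNIV"
      by simp
    have "?f (m + n + 1, m - n) = (q\<^sup>2) powi (n * (n + 1)) * (q\<^sup>2) powi (m + 1)\<^sup>2" for m n
      unfolding prod.case by (rule e[OF _ pronic_nonneg pronic_nonneg pronic_nonneg zero_le_power2]) (simp add: power2_eq_square algebra_simps)
    \<comment> \<open>Swapping the indices and shifting one of them by 1 reduces the odd class to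
      the sum \<open>P\<close> of the even class.\<close>
    moreover have "((\<lambda>(m, n). (q\<^sup>2) powi (n * (n + 1)) * (q\<^sup>2) powi (m + 1)\<^sup>2) has_sum (theta_psi (q\<^sup>2) * theta3 (q\<^sup>2))) UNIV"
      by (rule has_sum_reindex_bij_witness[where i = "\<lambda>(m, n). (n, m + 1)" and j = "\<lambda>(m, n). (n - 1, m)", THEN iffD1, rotated -1, OF P]) auto
    ultimately show "((\<lambda>(m, n). ?f (m + n + 1, m - n)) has_sum (theta_psi (q\<^sup>2) * theta3 (q\<^sup>2))) UNIV"
      by simp
  qed
  ultimately have "(theta_psi q)\<^sup>2 = theta_psi (q\<^sup>2) * theta3 (q\<^sup>2) + theta_psi (q\<^sup>2) * theta3 (q\<^sup>2)"
    by (rule has_sum_unique)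
  then show ?thesis by simp
qed

text \<open>Since (k + 1/2)^2 = 1/4 + k (k + 1), every term contains the same fourth root of q, and
  the fourth power removes the choice of branch.\<close>

lemma theta2_power4:
  assumes "q \<noteq> 0"
  shows "theta2 q ^ 4 = q * theta_psi q ^ 4"
proof -
  have "q powr ((of_int k + 1 / 2)\<^sup>2) = q powr (1 / 4) * q powi (k * (k + 1))" for k :: int
  proof -
    have *: "(of_int k + 1 / 2)\<^sup>2 = 1 / 4 + (of_int (k * (k + 1)) :: complex)"
      by (simp add: power2_eq_square field_simps)
    show ?thesis unfolding * powr_add
      using assms by (simp add: powr_of_int power_int_def power_inverse del: of_int_mult of_int_add)
  qed
  then have "theta2 q = q powr (1 / 4) * theta_psi q"
    unfolding theta2_def theta_psi_def by (simp add: infsum_cmult_right')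
  moreover have "(q powr (1 / 4)) ^ 4 = q"
    using assms by (simp add: powr_def exp_of_nat_mult[symmetric])
  ultimately show ?thesis by (simp add: power_mult_distrib)
qed

subsection \<open>Euler derivatives\<close>

text \<open>Because f vanishes at 0, it is O(|y|) there. Each use of the functional equation
  replaces y by its square and gains a factor of at most |c| |y|, which is at most 1/2 near 0.
  Iterating forces f to vanish near 0, and analytic continuation does the rest.\<close>

lemma square_functional_equation_imp_zero:
  fixes f :: "complex \<Rightarrow> complex"
  assumes hol: "f holomorphic_on ball 0 r" and r: "0 < r" and f0: "f 0 = 0"
    and fe: "\<And>q. q \<in> ball 0 r \<Longrightarrow> f q = c * f (q\<^sup>2)" and q: "q \<in> ball 0 r"
  shows "f q = 0"
proof -
  obtain D where "(f has_field_derivative D) (at 0)"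
    using hol r unfolding holomorphic_on_open[OF open_ball] by (meson centre_in_ball)
  then have "((\<lambda>y. (f y - f 0) / (y - 0)) \<longlongrightarrow> D) (at 0)"
    by (simp add: has_field_derivative_iff)
  then have "\<forall>\<^sub>F y in at 0. norm ((f y - f 0) / (y - 0)) < norm D + 1"
    by (intro order_tendstoD(2)[OF tendsto_norm]) auto
  then obtain d where d: "d > 0" and K: "\<And>y. y \<noteq> 0 \<Longrightarrow> norm y < d \<Longrightarrow> norm (f y / y) < norm D + 1"
    unfolding eventually_at by (auto simp: f0)
  define K where "K = norm D + 1"
  \<comment> \<open>The three bounds keep y inside the domain, inside the range of the difference
    quotient estimate, and small enough that |c| e is at most 1/2 and e < 1.\<close>
  define e where "e = Min {r, d, 1 / (2 * (norm c + 1))}"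
  have "0 < 1 / (2 * (norm c + 1))" by (intro divide_pos_pos) (auto simp: add_nonneg_pos)
  then have e: "0 < e" "e \<le> r" "e \<le> d" "e \<le> 1 / (2 * (norm c + 1))"
    using r d by (auto simp: e_def)
  have ce: "norm c * e \<le> 1 / 2"
  proof -
    have "norm c * e \<le> norm c * (1 / (2 * (norm c + 1)))" using e by (intro mult_left_mono) auto
    also have "\<dots> \<le> 1 / 2" using norm_ge_zero[of c] by (simp add: divide_simps del: norm_ge_zero)
    finally show ?thesis .
  qed
  have e1: "e < 1"
    using e(4) frac_le[of 1 1 2 "2 * (norm c + 1)"] by simp
  have bound: "norm (f y) \<le> (1 / 2) ^ n * K * norm y" if "norm y < e" for y n
    using that
  proof (induction n arbitrary: y)
    case 0
    then show ?case
      using K[of y] e by (cases "y = 0") (auto simp: f0 K_def norm_divide field_simps)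
  next
    case (Suc n)
    have y2: "norm (y\<^sup>2) \<le> e * norm y"
      using Suc.prems by (simp add: norm_mult power2_eq_square mult_right_mono)
    also have "\<dots> < e"
      using mult_strict_left_mono[of "norm y" 1 e] Suc.prems e1 e(1) by simp
    finally have IH: "norm (f (y\<^sup>2)) \<le> (1 / 2) ^ n * K * norm (y\<^sup>2)" by (rule Suc.IH)
    have "norm (f y) = norm c * norm (f (y\<^sup>2))"
      using fe[of y] Suc.prems e by (auto simp: norm_mult)
    also have "\<dots> \<le> norm c * ((1 / 2) ^ n * K * (e * norm y))"
      by (intro mult_left_mono order.trans[OF IH] y2) (auto simp: K_def)
    also have "\<dots> = (norm c * e) * ((1 / 2) ^ n * K * norm y)" by (simp add: mult_ac)
    also have "\<dots> \<le> (1 / 2) * ((1 / 2) ^ n * K * norm y)"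
      by (intro mult_right_mono ce) (auto simp: K_def)
    finally show ?case by simp
  qed
  have small: "f y = 0" if "y \<in> ball 0 e" for y
  proof -
    have "(\<lambda>n. (1 / 2) ^ n * (K * norm y)) \<longlonglongrightarrow> 0 * (K * norm y)"
      by (intro tendsto_mult LIMSEQ_realpow_zero tendsto_const) auto
    then have "norm (f y) \<le> 0 * (K * norm y)"
      by (rule LIMSEQ_le_const) (use bound[of y] that in \<open>auto simp: mult_ac\<close>)
    then show ?thesis by simp
  qed
  show ?thesis
    by (rule analytic_continuation[OF hol, of "ball 0 e" 0]) (use e r small q in \<open>auto simp: islimpt_ball\<close>)
qed

text \<open>The operator q d/dq as a relation: it carries differentiability along with the value, so
  the product and chain rules compose directly. At q = 0 it forces d = 0.\<close>

definition euler_deriv :: "(complex \<Rightarrow> complex) \<Rightarrow> complex \<Rightarrow> complex \<Rightarrow> bool" where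
  "euler_deriv f d q \<longleftrightarrow> (\<exists>D. (f has_field_derivative D) (at q) \<and> d = q * D)"

lemma euler_deriv_unique: "euler_deriv f d q \<Longrightarrow> euler_deriv f d' q \<Longrightarrow> d = d'"
  unfolding euler_deriv_def by (auto dest: DERIV_unique)

lemma euler_deriv_cong: "euler_deriv f d q \<Longrightarrow> d = d' \<Longrightarrow> euler_deriv f d' q"
  by simp

lemma euler_deriv_transform:
  assumes "euler_deriv f d q" "q \<in> ball 0 r" "\<And>x. x \<in> ball 0 r \<Longrightarrow> f x = g x"
  shows "euler_deriv g d q"
proof -
  obtain D where D: "(f has_field_derivative D) (at q)" "d = q * D"
    using assms(1) by (auto simp: euler_deriv_def)
  have "(g has_field_derivative D) (at q)"
    by (rule has_field_derivative_transform_within_open[OF D(1) open_ball assms(2)]) (rule assms(3))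
  with D(2) show ?thesis by (auto simp: euler_deriv_def)
qed

lemma euler_deriv_const: "euler_deriv (\<lambda>_. c) 0 q"
  unfolding euler_deriv_def by (auto intro!: exI[of _ 0])

lemma euler_deriv_add:
  "euler_deriv f d q \<Longrightarrow> euler_deriv g e q \<Longrightarrow> euler_deriv (\<lambda>x. f x + g x) (d + e) q"
  unfolding euler_deriv_def
  by (elim exE conjE, rule exI, rule conjI, rule DERIV_add, assumption, assumption) (simp add: algebra_simps)

lemma euler_deriv_diff:
  "euler_deriv f d q \<Longrightarrow> euler_deriv g e q \<Longrightarrow> euler_deriv (\<lambda>x. f x - g x) (d - e) q"
  unfolding euler_deriv_def
  by (elim exE conjE, rule exI, rule conjI, rule DERIV_diff, assumption, assumption) (simp add: algebra_simps)

lemma euler_deriv_mult: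
  "euler_deriv f d q \<Longrightarrow> euler_deriv g e q \<Longrightarrow> euler_deriv (\<lambda>x. f x * g x) (d * g q + f q * e) q"
  unfolding euler_deriv_def
  by (elim exE conjE, rule exI, rule conjI, rule DERIV_mult, assumption, assumption) (simp add: algebra_simps)

lemma euler_deriv_square_arg:
  "euler_deriv f d (q\<^sup>2) \<Longrightarrow> euler_deriv (\<lambda>x. f (x\<^sup>2)) (2 * d) q"
  unfolding euler_deriv_def
proof clarify
  fix D assume D: "(f has_field_derivative D) (at (q\<^sup>2))"
  have "((\<lambda>x. x\<^sup>2) has_field_derivative 2 * q) (at q)"
    by (auto intro!: derivative_eq_intros)
  from DERIV_chain2[OF D this]
  show "\<exists>Da. ((\<lambda>x. f (x\<^sup>2)) has_field_derivative Da) (at q) \<and> 2 * (q\<^sup>2 * D) = q * Da"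
    by (intro exI conjI) (auto simp: power2_eq_square)
qed

lemmas euler_deriv_intros =
  euler_deriv_const euler_deriv_add euler_deriv_diff euler_deriv_mult euler_deriv_square_arg

lemma euler_deriv_holomorphic:
  assumes "f holomorphic_on ball 0 r" "q \<in> ball 0 r"
  shows "euler_deriv f (q * deriv f q) q"
  using holomorphic_derivI[OF assms(1) open_ball assms(2)] unfolding euler_deriv_def by auto

text \<open>Away from 0 a zero Euler derivative gives a zero derivative. At 0 it gives only
  continuity, so the origin is treated as an exceptional point of the connected ball.\<close>

lemma euler_deriv_zero_imp_constant:
  assumes "\<And>x. x \<in> ball 0 r \<Longrightarrow> euler_deriv f 0 x" "q \<in> ball 0 r"
  shows "f q = f 0"
proof -
  have "continuous_on (ball 0 r) f"
    using assms(1) unfolding euler_deriv_def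
    by (meson DERIV_isCont continuous_at_imp_continuous_on)
  moreover have "(f has_field_derivative 0) (at x)" if "x \<in> ball 0 r - {0}" for x
    using assms(1)[of x] that by (auto simp: euler_deriv_def)
  ultimately obtain c where "\<And>x. x \<in> ball 0 r \<Longrightarrow> f x = c"
    using DERIV_zero_connected_constant[of "ball 0 r" "{0}" f] by auto
  moreover have "0 \<in> ball (0::complex) r" using assms(2) by (auto intro: le_less_trans[OF norm_ge_zero])
  ultimately show ?thesis using assms(2) by metis
qed

subsection \<open>Differential equations for the modulus and \<open>theta3\<close>\<close>

text \<open>
  \<open>theta_lam\<close> extends \<open>theta_alpha\<close> holomorphically to \<open>0\<close>, and \<open>theta_xi q\<close> is the holomorphic square
  root of \<open>theta_lam (q\<^sup>2)\<close>.
\<close>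

definition theta_lam :: "complex \<Rightarrow> complex" where
  "theta_lam q = q * (theta_psi q / theta3 q) ^ 4"

definition theta_xi :: "complex \<Rightarrow> complex" where
  "theta_xi q = q * (theta_psi (q\<^sup>2) / theta3 (q\<^sup>2))\<^sup>2"

text \<open>The radius makes crude geometric estimates sufficient: here \<open>theta3\<close> stays
  near 1, \<open>theta_psi\<close> near 2, and the hypergeometric argument inside the unit
  disc.\<close>

abbreviation small_disc :: "complex set" where
  "small_disc \<equiv> ball 0 (1 / 100)"

section \<open>Estimates and non-vanishing on the small disc\<close>

lemma small_disc_square: "q \<in> small_disc \<Longrightarrow> q\<^sup>2 \<in> small_disc"
  using mult_mono[of "norm q" 1 "norm q" "norm q"] by (auto simp: norm_mult power2_eq_square)

lemma small_disc_norm: "q \<in> small_disc \<Longrightarrow> norm q < 1"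
  by simp

lemma
  assumes "q \<in> small_disc"
  shows theta3_near_1: "norm (theta3 q - 1) \<le> 1 / 40" and theta_psi_near_2: "norm (theta_psi q - 2) \<le> 1 / 40"
proof -
  have "2 * norm q / (1 - norm q) \<le> 1 / 40" using assms by (simp add: divide_simps)
  moreover have "norm q < 1" using assms by simp
  ultimately show "norm (theta3 q - 1) \<le> 1 / 40" "norm (theta_psi q - 2) \<le> 1 / 40"
    using theta3_bound[of q] theta_psi_bound[of q] by linarith+
qed

lemma theta3_nonzero: "q \<in> small_disc \<Longrightarrow> theta3 q \<noteq> 0"
  using theta3_near_1[of q] by auto

lemma theta_psi_nonzero: "q \<in> small_disc \<Longrightarrow> theta_psi q \<noteq> 0"
  using theta_psi_near_2[of q] by auto

lemma theta3_0: "theta3 0 = 1"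
  using theta3_bound[of 0] by simp

text \<open>The bound 1/5 is strong enough for the hypergeometric argument, because 4 (1/5) (6/5) =
  24/25 < 1.\<close>

lemma theta_lam_bound:
  assumes "q \<in> small_disc"
  shows "norm (theta_lam q) \<le> 1 / 5"
proof -
  have 3: "39 / 40 \<le> norm (theta3 q)"
    using theta3_near_1[OF assms] norm_triangle_ineq2[of 1 "1 - theta3 q"] by (simp add: norm_minus_commute)
  have p: "norm (theta_psi q) \<le> 81 / 40"
    using theta_psi_near_2[OF assms] norm_triangle_ineq2[of "theta_psi q" 2] by simp
  have "norm (theta_psi q) / norm (theta3 q) \<le> (81 / 40) / (39 / 40)"
    using 3 p by (intro frac_le) auto
  then have "norm (theta_lam q) \<le> 1 / 100 * ((81 / 40) / (39 / 40)) ^ 4"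
    using assms unfolding theta_lam_def norm_mult norm_power norm_divide
    by (intro mult_mono power_mono) auto
  also have "\<dots> \<le> 1 / 5" by (simp add: power4_eq_xxxx)
  finally show ?thesis .
qed

lemma theta_lam_not_1: "q \<in> small_disc \<Longrightarrow> 1 - theta_lam q \<noteq> 0"
  using theta_lam_bound[of q] by auto

lemma clausen_argument_bound:
  assumes "q \<in> small_disc"
  shows "norm (4 * theta_lam q * (1 - theta_lam q)) < 1"
proof -
  have "norm (1 - theta_lam q) \<le> 1 + 1 / 5"
    using theta_lam_bound[OF assms] norm_triangle_ineq4[of 1 "theta_lam q"] by simp
  then have "norm (4 * theta_lam q * (1 - theta_lam q)) \<le> 4 * (1 / 5) * (1 + 1 / 5)"
    unfolding norm_mult using theta_lam_bound[OF assms] by (intro mult_mono) auto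
  then show ?thesis by simp
qed

section \<open>Landen transformation\<close>

lemma theta3_square_xi:
  assumes "q \<in> small_disc"
  shows "(theta3 q)\<^sup>2 = (theta3 (q\<^sup>2))\<^sup>2 * (1 + theta_xi q)"
  using theta3_square[of q] theta3_nonzero[OF small_disc_square[OF assms]] assms
  by (simp add: theta_xi_def field_simps)

lemma one_plus_xi_nonzero: "q \<in> small_disc \<Longrightarrow> 1 + theta_xi q \<noteq> 0"
  using theta3_square_xi[of q] theta3_nonzero[of q] by auto

lemma theta_lam_square: "theta_lam (q\<^sup>2) = (theta_xi q)\<^sup>2"
  by (simp add: theta_lam_def theta_xi_def power_mult_distrib flip: power_mult)

text \<open>Divide the fourth power of \<open>theta_psi\<close> by that of \<open>theta3\<close>
  using the two duplication formulas. With the elliptic moduli k at q and l at the square of q,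
  where l = \<open>theta_xi q\<close>, this is the classical relation k^2 = 4 l / (1 + l)^2.\<close>

lemma theta_lam_landen:
  assumes "q \<in> small_disc"
  shows "theta_lam q * (1 + theta_xi q)\<^sup>2 = 4 * theta_xi q"
proof -
  have "theta_lam q * (1 + theta_xi q)\<^sup>2 = q * ((theta_psi q)\<^sup>2)\<^sup>2 / ((theta3 q)\<^sup>2)\<^sup>2 * (1 + theta_xi q)\<^sup>2"
    by (simp add: theta_lam_def power_divide flip: power_mult)
  also have "\<dots> = 4 * theta_xi q"
    using one_plus_xi_nonzero[OF assms] theta3_nonzero[OF small_disc_square[OF assms]] assms
    unfolding theta3_square_xi[OF assms] theta_psi_square[OF small_disc_norm[OF assms]]
    by (simp add: power_mult_distrib power_divide) (simp add: theta_xi_def power_divide field_simps power2_eq_square power4_eq_xxxx)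
  finally show ?thesis .
qed

lemma one_minus_lam_landen:
  assumes "q \<in> small_disc"
  shows "(1 - theta_lam q) * (1 + theta_xi q)\<^sup>2 = (1 - theta_xi q)\<^sup>2"
  using theta_lam_landen[OF assms] by (simp add: algebra_simps power2_eq_square)

lemma one_minus_xi_nonzero: "q \<in> small_disc \<Longrightarrow> 1 - theta_xi q \<noteq> 0"
  using one_minus_lam_landen[of q] theta_lam_not_1[of q] one_plus_xi_nonzero[of q] by auto

lemma theta_xi_nonzero: "q \<in> small_disc \<Longrightarrow> q \<noteq> 0 \<Longrightarrow> theta_xi q \<noteq> 0"
  using theta3_nonzero[of "q\<^sup>2"] theta_psi_nonzero[of "q\<^sup>2"] small_disc_square[of q]
  by (simp add: theta_xi_def)

lemma theta3_holomorphic_small [holomorphic_intros]: "theta3 holomorphic_on small_disc"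
  by (rule holomorphic_on_subset[OF theta3_holomorphic]) auto

lemma theta_psi_holomorphic_small [holomorphic_intros]: "theta_psi holomorphic_on small_disc"
  by (rule holomorphic_on_subset[OF theta_psi_holomorphic]) auto

lemma theta_lam_holomorphic [holomorphic_intros]: "theta_lam holomorphic_on small_disc"
  unfolding theta_lam_def using theta3_nonzero by (intro holomorphic_intros) auto

lemma holomorphic_square_arg:
  "f holomorphic_on small_disc \<Longrightarrow> (\<lambda>q. f (q\<^sup>2)) holomorphic_on small_disc"
  using small_disc_square
  by (intro holomorphic_on_compose_gen[of "\<lambda>q. q\<^sup>2" small_disc f small_disc, unfolded o_def] holomorphic_intros) auto

lemma theta_xi_holomorphic [holomorphic_intros]: "theta_xi holomorphic_on small_disc"
  unfolding theta_xi_def using theta3_nonzero[OF small_disc_square]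
  by (intro holomorphic_intros holomorphic_square_arg) auto

section \<open>Differential equation of the modulus\<close>

lemma xi_deriv_relation:
  assumes "q \<in> small_disc"
  shows "theta_xi q * (q * deriv theta_xi q) = q\<^sup>2 * deriv theta_lam (q\<^sup>2)"
proof -
  have "euler_deriv (\<lambda>q. theta_lam (q\<^sup>2)) (2 * (q\<^sup>2 * deriv theta_lam (q\<^sup>2))) q"
    using assms small_disc_square by (intro euler_deriv_square_arg euler_deriv_holomorphic[OF theta_lam_holomorphic]) auto
  then have l: "euler_deriv (\<lambda>q. theta_xi q * theta_xi q) (2 * (q\<^sup>2 * deriv theta_lam (q\<^sup>2))) q"
    by (simp add: theta_lam_square flip: power2_eq_square)
  have "euler_deriv (\<lambda>q. theta_xi q * theta_xi q)
      ((q * deriv theta_xi q) * theta_xi q + theta_xi q * (q * deriv theta_xi q)) q"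
    using assms by (intro euler_deriv_mult euler_deriv_holomorphic[OF theta_xi_holomorphic]) auto
  from euler_deriv_unique[OF l this] show ?thesis by (simp add: algebra_simps)
qed

text \<open>Differentiate the Landen relation, multiply by 1 + xi, and eliminate
  \<open>theta_lam\<close> by the same relation; the coefficient becomes 4 (1 + xi) - 8 xi = 4 (1 -
  xi).\<close>

lemma lam_deriv_relation:
  assumes "q \<in> small_disc"
  shows "q * deriv theta_lam q * (1 + theta_xi q) ^ 3 = 4 * (1 - theta_xi q) * (q * deriv theta_xi q)"
proof -
  let ?x = "theta_xi q" and ?l = "theta_lam q" and ?dx = "q * deriv theta_xi q" and ?dl = "q * deriv theta_lam q"
  have "euler_deriv (\<lambda>q. theta_lam q * ((1 + theta_xi q) * (1 + theta_xi q)))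
     (?dl * ((1 + ?x) * (1 + ?x)) + ?l * ((0 + ?dx) * (1 + ?x) + (1 + ?x) * (0 + ?dx))) q"
    using assms by (intro euler_deriv_intros euler_deriv_holomorphic[OF theta_xi_holomorphic] euler_deriv_holomorphic[OF theta_lam_holomorphic])
  then have l: "euler_deriv (\<lambda>q. 4 * theta_xi q)
     (?dl * ((1 + ?x) * (1 + ?x)) + ?l * ((0 + ?dx) * (1 + ?x) + (1 + ?x) * (0 + ?dx))) q"
    by (rule euler_deriv_transform[OF _ assms]) (simp add: theta_lam_landen flip: power2_eq_square)
  have "euler_deriv (\<lambda>q. 4 * theta_xi q) (0 * ?x + 4 * ?dx) q"
    using assms by (intro euler_deriv_intros euler_deriv_holomorphic[OF theta_xi_holomorphic])
  from euler_deriv_unique[OF l this] have "?dl * (1 + ?x)\<^sup>2 + 2 * ?l * (1 + ?x) * ?dx = 4 * ?dx"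
    by (simp add: power2_eq_square algebra_simps)
  from arg_cong[OF this, of "\<lambda>y. y * (1 + ?x)"]
  have "?dl * (1 + ?x) ^ 3 + 2 * (?l * (1 + ?x)\<^sup>2) * ?dx = 4 * (1 + ?x) * ?dx"
    by (simp add: power2_eq_square power3_eq_cube algebra_simps)
  then show ?thesis
    unfolding theta_lam_landen[OF assms] by (simp add: algebra_simps)
qed

text \<open>The relative error \<open>F\<close> is invariant under squaring the argument: the Landen
  relations express all ingredients at q and at its square rationally through
  \<open>theta_xi\<close>, and the two derivative relations link the derivatives of
  \<open>theta_lam\<close>.\<close>

lemma euler_lam:
  assumes "q \<in> small_disc"
  shows "q * deriv theta_lam q = theta_lam q * (1 - theta_lam q) * theta3 q ^ 4"
proof -
  define A where "A = (\<lambda>q. (theta_psi q / theta3 q) ^ 4)"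
  \<comment> \<open>Dividing by \<open>A\<close> after cancelling the common factor q makes
    \<open>F\<close> holomorphic at the origin, where \<open>theta_lam\<close> has its zero.\<close>
  define F where "F = (\<lambda>q. deriv theta_lam q / (A q * (1 - theta_lam q) * theta3 q ^ 4) - 1)"
  have lam: "theta_lam q = q * A q" for q by (simp add: theta_lam_def A_def)
  have A0: "A q \<noteq> 0" if "q \<in> small_disc" for q
    using theta3_nonzero[OF that] theta_psi_nonzero[OF that] by (simp add: A_def)
  have [holomorphic_intros]: "A holomorphic_on small_disc"
    unfolding A_def using theta3_nonzero by (intro holomorphic_intros) auto
  have "F q = 0"
  proof (rule square_functional_equation_imp_zero[OF _ _ _ _ assms, of F 1])
    show "F holomorphic_on small_disc"
      unfolding F_def using theta3_nonzero A0 theta_lam_not_1 by (intro holomorphic_intros) auto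
    have "((\<lambda>q. q * A q) has_field_derivative (1 * A 0 + deriv A 0 * 0)) (at 0)"
      using \<open>A holomorphic_on small_disc\<close> by (intro DERIV_mult DERIV_ident) (auto intro: holomorphic_derivI)
    then have "deriv theta_lam 0 = A 0"
      by (auto simp: lam[abs_def] intro: DERIV_imp_deriv)
    then show "F 0 = 0" using A0[of 0] by (simp add: F_def lam theta3_0)
    show "F q = 1 * F (q\<^sup>2)" if q: "q \<in> small_disc" for q
    proof (cases "q = 0")
      case False
      let ?x = "theta_xi q" and ?d = "deriv theta_lam"
      have x: "?x \<noteq> 0" "1 + ?x \<noteq> 0" "1 - ?x \<noteq> 0"
        using theta_xi_nonzero one_plus_xi_nonzero one_minus_xi_nonzero q False by auto
      have A2: "A (q\<^sup>2) = ?x\<^sup>2 / q\<^sup>2" using False theta_lam_square[of q] unfolding lam by (simp add: eq_divide_eq mult.commute)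
      have A1: "A q = 4 * ?x / (q * (1 + ?x)\<^sup>2)"
        using False theta_lam_landen[OF q] x by (simp add: lam field_simps)
      have L1: "1 - theta_lam q = (1 - ?x)\<^sup>2 / (1 + ?x)\<^sup>2"
        using one_minus_lam_landen[OF q] x by (simp add: field_simps)
      have L2: "1 - theta_lam (q\<^sup>2) = (1 - ?x) * (1 + ?x)"
        unfolding theta_lam_square by (simp add: power2_eq_square algebra_simps)
      have T: "theta3 q ^ 4 = (1 + ?x)\<^sup>2 * theta3 (q\<^sup>2) ^ 4"
      proof -
        have "theta3 q ^ 4 = ((theta3 q)\<^sup>2)\<^sup>2" by simp
        then show ?thesis unfolding theta3_square_xi[OF q] by (simp add: power_mult_distrib)
      qed
      have "?d q * (1 + ?x) ^ 3 = 4 * (1 - ?x) * deriv theta_xi q"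
        using lam_deriv_relation[OF q] False by simp
      then have "?d q = 4 * (1 - ?x) * deriv theta_xi q / (1 + ?x) ^ 3"
        using x by (simp add: eq_divide_eq)
      moreover have "?x * deriv theta_xi q = q * ?d (q\<^sup>2)"
        using xi_deriv_relation[OF q] False by (simp add: power2_eq_square)
      then have "deriv theta_xi q = q * ?d (q\<^sup>2) / ?x"
        using x by (simp add: eq_divide_eq mult.commute)
      ultimately have D: "?d q = 4 * (1 - ?x) * (q * ?d (q\<^sup>2) / ?x) / (1 + ?x) ^ 3"
        by simp
      have t: "theta3 (q\<^sup>2) \<noteq> 0" using theta3_nonzero small_disc_square q by blast
      \<comment> \<open>The remaining rational identity in independent variables, with s and r
        standing for 1 + xi and 1 - xi.\<close>
      have aux: "4 * r * (q * d / x) / s ^ 3 / (4 * x / (q * s\<^sup>2) * (r\<^sup>2 / s\<^sup>2) * (s\<^sup>2 * t ^ 4)) = d / (x\<^sup>2 / q\<^sup>2 * (r * s) * t ^ 4)"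
        if "x \<noteq> 0" "q \<noteq> 0" "s \<noteq> 0" "r \<noteq> 0" "t \<noteq> 0" for q d x s r t :: complex
        using that by (simp add: divide_simps power2_eq_square power3_eq_cube)
      show ?thesis
        unfolding F_def A2 A1 L1 L2 T D using aux[OF x(1) False x(2,3) t] by simp
    qed (simp add: F_def)
  qed auto
  then have "deriv theta_lam q = A q * (1 - theta_lam q) * theta3 q ^ 4"
    using A0[OF assms] theta_lam_not_1[OF assms] theta3_nonzero[OF assms] by (simp add: F_def field_simps)
  then show ?thesis by (simp add: lam)
qed

section \<open>Second-order equation for the reciprocal of the square of
  \<open>theta3\<close>\<close>

definition theta_w :: "complex \<Rightarrow> complex" where
  "theta_w q = 1 / (theta3 q)\<^sup>2"

text \<open>The Euler derivative of \<open>theta_w\<close>. Once \<open>euler_p\<close> is known,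
  the Euler derivatives of \<open>theta_lam\<close>, \<open>theta3 ^ 2\<close>,
  \<open>theta_w\<close> and \<open>theta_p\<close> are polynomials in these four functions, so
  later differentiation is pure algebra.\<close>

definition theta_p :: "complex \<Rightarrow> complex" where
  "theta_p q = q * deriv theta_w q"

lemma theta_w_holomorphic [holomorphic_intros]: "theta_w holomorphic_on small_disc"
  unfolding theta_w_def using theta3_nonzero by (intro holomorphic_intros) auto

lemma theta_p_holomorphic [holomorphic_intros]: "theta_p holomorphic_on small_disc"
  unfolding theta_p_def by (intro holomorphic_intros) auto

lemma euler_deriv_lam:
  "q \<in> small_disc \<Longrightarrow> euler_deriv theta_lam (theta_lam q * (1 - theta_lam q) * (theta3 q)\<^sup>2 * (theta3 q)\<^sup>2) q"
  using euler_deriv_holomorphic[OF theta_lam_holomorphic, of q] euler_lam[of q]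
  by (simp add: mult.assoc flip: power_add)

lemma euler_deriv_w: "q \<in> small_disc \<Longrightarrow> euler_deriv theta_w (theta_p q) q"
  unfolding theta_p_def by (intro euler_deriv_holomorphic[OF theta_w_holomorphic])

text \<open>Differentiate the identity \<open>theta_w q * theta3 q ^ 2 = 1\<close>.\<close>

lemma euler_deriv_theta3_square:
  assumes "q \<in> small_disc"
  shows "euler_deriv (\<lambda>q. (theta3 q)\<^sup>2) (- (theta3 q)\<^sup>2 * (theta3 q)\<^sup>2 * theta_p q) q"
proof -
  let ?d = "q * deriv (\<lambda>q. (theta3 q)\<^sup>2) q"
  have d: "euler_deriv (\<lambda>q. (theta3 q)\<^sup>2) ?d q"
    by (rule euler_deriv_holomorphic[OF _ assms]) (intro holomorphic_intros)
  have "euler_deriv (\<lambda>q. theta_w q * (theta3 q)\<^sup>2) (theta_p q * (theta3 q)\<^sup>2 + theta_w q * ?d) q"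
    using assms by (intro euler_deriv_intros euler_deriv_w d)
  then have "euler_deriv (\<lambda>q. 1) (theta_p q * (theta3 q)\<^sup>2 + theta_w q * ?d) q"
    by (rule euler_deriv_transform[OF _ assms]) (simp add: theta_w_def theta3_nonzero)
  then have "theta_p q * (theta3 q)\<^sup>2 + theta_w q * ?d = 0"
    using euler_deriv_const by (rule euler_deriv_unique)
  then have "?d = - (theta3 q)\<^sup>2 * (theta3 q)\<^sup>2 * theta_p q"
    using theta3_nonzero[OF assms] by (simp add: theta_w_def field_simps eq_neg_iff_add_eq_0)
  with d show ?thesis by simp
qed

text \<open>For nonzero q cancel \<open>theta_xi q\<close> in \<open>xi_deriv_relation\<close> after
  inserting \<open>euler_lam\<close>; at q = 0 both sides vanish.\<close>

lemma euler_deriv_xi: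
  assumes "q \<in> small_disc"
  shows "euler_deriv theta_xi (theta_xi q * (1 - theta_xi q * theta_xi q) * ((theta3 (q\<^sup>2))\<^sup>2 * (theta3 (q\<^sup>2))\<^sup>2)) q"
proof -
  have "q * deriv theta_xi q = theta_xi q * (1 - theta_xi q * theta_xi q) * theta3 (q\<^sup>2) ^ 4"
  proof (cases "q = 0")
    case False
    have "theta_xi q * (q * deriv theta_xi q) = theta_xi q * (theta_xi q * (1 - (theta_xi q)\<^sup>2) * theta3 (q\<^sup>2) ^ 4)"
      unfolding xi_deriv_relation[OF assms] euler_lam[OF small_disc_square[OF assms]] theta_lam_square
      by (simp add: power2_eq_square)
    then show ?thesis
      using theta_xi_nonzero[OF assms False] by (simp add: power2_eq_square)
  qed (simp add: theta_xi_def)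
  then show ?thesis
    using euler_deriv_holomorphic[OF theta_xi_holomorphic assms] by (simp flip: power_add)
qed

text \<open>Apply q d/dq twice to the duplication formula for \<open>theta_w\<close>, stated as
  \<open>weq\<close> below. Each application on the squared argument gives a factor 2, so
  \<open>S q = 4 * S (q ^ 2)\<close> results, with the Landen relations matching the
  non-differentiated terms.\<close>

lemma euler_p:
  assumes "q \<in> small_disc"
  shows "q * deriv theta_p q = - theta_lam q * (1 - theta_lam q) * theta3 q ^ 6 / 4"
proof -
  define S where "S = (\<lambda>q. (theta3 q)\<^sup>2 * (q * deriv theta_p q) + theta_lam q * (1 - theta_lam q) * ((theta3 q)\<^sup>2) ^ 4 / 4)"
  have "S q = 0"
  proof (rule square_functional_equation_imp_zero[OF _ _ _ _ assms, of S 4])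
    show "S holomorphic_on small_disc"
      unfolding S_def by (intro holomorphic_intros) auto
    show "S 0 = 0" by (simp add: S_def theta_lam_def)
    show "S q = 4 * S (q\<^sup>2)" if q: "q \<in> small_disc" for q
    proof -
      have q2: "q\<^sup>2 \<in> small_disc" using small_disc_square[OF q] .
      define x Z p2 dp2 where defs: "x = theta_xi q" "Z = (theta3 (q\<^sup>2))\<^sup>2" "p2 = theta_p (q\<^sup>2)" "dp2 = q\<^sup>2 * deriv theta_p (q\<^sup>2)"
      define p dp w where defs': "p = theta_p q" "dp = q * deriv theta_p q" "w = theta_w q"
      define dx where "dx = x * (1 - x * x) * (Z * Z)"
      have dp: "euler_deriv theta_p dp q" and dp2: "euler_deriv theta_p dp2 (q\<^sup>2)"
        unfolding defs defs' by (intro euler_deriv_holomorphic[OF theta_p_holomorphic] q q2)+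
      have nz: "1 + x \<noteq> 0" "Z \<noteq> 0"
        using one_plus_xi_nonzero[OF q] theta3_nonzero[OF q2] by (auto simp: defs)
      have Z1: "(theta3 q)\<^sup>2 = Z * (1 + x)" using theta3_square_xi[OF q] by (simp add: defs)
      have w: "w * (Z * (1 + x)) = 1" using nz by (simp add: defs' theta_w_def Z1)
      have weq: "theta_w y * (1 + theta_xi y) = theta_w (y\<^sup>2)" if "y \<in> small_disc" for y
        unfolding theta_w_def theta3_square_xi[OF that] using one_plus_xi_nonzero[OF that] by simp
      have E1: "theta_p y * (1 + theta_xi y) + theta_w y * (theta_xi y * (1 - theta_xi y * theta_xi y) * ((theta3 (y\<^sup>2))\<^sup>2 * (theta3 (y\<^sup>2))\<^sup>2)) = 2 * theta_p (y\<^sup>2)"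
        if y: "y \<in> small_disc" for y
      proof -
        have "euler_deriv (\<lambda>y. theta_w y * (1 + theta_xi y))
           (theta_p y * (1 + theta_xi y) + theta_w y * (0 + theta_xi y * (1 - theta_xi y * theta_xi y) * ((theta3 (y\<^sup>2))\<^sup>2 * (theta3 (y\<^sup>2))\<^sup>2))) y"
          by (intro euler_deriv_intros euler_deriv_w euler_deriv_xi y)
        then have l: "euler_deriv (\<lambda>y. theta_w (y\<^sup>2)) 
           (theta_p y * (1 + theta_xi y) + theta_w y * (0 + theta_xi y * (1 - theta_xi y * theta_xi y) * ((theta3 (y\<^sup>2))\<^sup>2 * (theta3 (y\<^sup>2))\<^sup>2))) y"
          by (rule euler_deriv_transform[OF _ y]) (rule weq)
        have "euler_deriv (\<lambda>y. theta_w (y\<^sup>2)) (2 * theta_p (y\<^sup>2)) y"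
          by (intro euler_deriv_intros euler_deriv_w small_disc_square[OF y])
        from euler_deriv_unique[OF l this] show ?thesis by simp
      qed
      let ?dZ = "2 * (- Z * Z * p2)"
      \<comment> \<open>The second derivative in the unsimplified shape that the product rules
        produce.\<close>
      let ?L = "dp * (1 + x) + p * (0 + dx) + (p * dx + w * ((dx * (1 - x * x) + x * (0 - (dx * x + x * dx))) * (Z * Z)
            + x * (1 - x * x) * (?dZ * Z + Z * ?dZ)))"
      have "euler_deriv (\<lambda>y. theta_p y * (1 + theta_xi y) + theta_w y * (theta_xi y * (1 - theta_xi y * theta_xi y) * ((theta3 (y\<^sup>2))\<^sup>2 * (theta3 (y\<^sup>2))\<^sup>2))) ?L q"
        unfolding dx_def defs defs'
        by (intro euler_deriv_intros euler_deriv_w euler_deriv_xi q euler_deriv_square_arg[where f = "\<lambda>q. (theta3 q)\<^sup>2"] euler_deriv_theta3_square q2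
               euler_deriv_holomorphic[OF theta_p_holomorphic])
      then have l: "euler_deriv (\<lambda>y. 2 * theta_p (y\<^sup>2)) ?L q"
        by (rule euler_deriv_transform[OF _ q]) (rule E1)
      have "euler_deriv (\<lambda>y. 2 * theta_p (y\<^sup>2)) (0 * theta_p (q\<^sup>2) + 2 * (2 * dp2)) q"
        by (intro euler_deriv_intros dp2)
      from euler_deriv_unique[OF l this] have E2: "?L = 4 * dp2" by simp
      \<comment> \<open>The factor w occurs only through w Z (1 + x) = 1, so it can be eliminated
        from the first derivative.\<close>
      have E1': "p * (1 + x) = 2 * p2 - x * (1 - x) * Z"
      proof -
        have "w * dx = x * (1 - x) * Z * (w * (Z * (1 + x)))" by (simp add: dx_def algebra_simps)
        then have "w * dx = x * (1 - x) * Z" by (simp only: w mult_1_right)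
        moreover have "p * (1 + x) + w * dx = 2 * p2" using E1[OF q] by (simp only: defs defs' dx_def)
        ultimately show ?thesis by (simp add: eq_diff_eq)
      qed
      \<comment> \<open>Substituting the first-order relation cancels all terms with
        \<open>p2\<close>, leaving only \<open>dp2\<close> and a polynomial in x times the cube of
        Z.\<close>
      have E3: "dp * (1 + x) = 4 * dp2 - x * (1 - x) * (1 - 2 * x - x * x) * (Z * Z * Z)"
      proof -
        have 1: "p * dx = x * (1 - x) * Z * Z * (2 * p2 - x * (1 - x) * Z)"
          unfolding E1'[symmetric] by (simp add: dx_def algebra_simps)
        have 2: "w * ((dx * (1 - x * x) + x * (0 - (dx * x + x * dx))) * (Z * Z) + x * (1 - x * x) * (?dZ * Z + Z * ?dZ))
          = (w * (Z * (1 + x))) * (x * (1 - x) * ((1 - 3 * x * x) * (Z * Z * Z) - 4 * Z * Z * p2))"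
          by (simp add: dx_def algebra_simps)
        have "dp * (1 + x) + 2 * (p * dx) + x * (1 - x) * ((1 - 3 * x * x) * (Z * Z * Z) - 4 * Z * Z * p2) = 4 * dp2"
          using E2 unfolding 2 w by (simp add: ac_simps)
        then show ?thesis unfolding 1 by (simp add: algebra_simps)
      qed
      have L: "theta_lam q * (1 + x)\<^sup>2 = 4 * x" "(1 - theta_lam q) * (1 + x)\<^sup>2 = (1 - x)\<^sup>2"
        using theta_lam_landen[OF q] one_minus_lam_landen[OF q] by (auto simp: defs)
      have "S q = Z * (dp * (1 + x)) + (theta_lam q * (1 + x)\<^sup>2) * ((1 - theta_lam q) * (1 + x)\<^sup>2) * Z ^ 4 / 4"
      proof -
        have "(Z * (1 + x)) ^ 4 = (1 + x)\<^sup>2 * (1 + x)\<^sup>2 * Z ^ 4"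
          by (simp add: power_mult_distrib flip: power_add)
        then show ?thesis unfolding S_def Z1 by (simp only: defs') (simp add: mult_ac)
      qed
      also have "\<dots> = 4 * (Z * dp2 + x\<^sup>2 * (1 - x\<^sup>2) * Z ^ 4 / 4)"
        unfolding L E3 by (simp add: field_simps power2_eq_square power4_eq_xxxx)
      also have "\<dots> = 4 * S (q\<^sup>2)"
        unfolding S_def theta_lam_square by (simp add: defs)
      finally show ?thesis .
    qed
  qed auto
  then have "(theta3 q)\<^sup>2 * (q * deriv theta_p q + theta_lam q * (1 - theta_lam q) * theta3 q ^ 6 / 4) = 0"
    by (simp add: S_def algebra_simps flip: power_mult power_add)
  then have "q * deriv theta_p q + theta_lam q * (1 - theta_lam q) * theta3 q ^ 6 / 4 = 0"
    using theta3_nonzero[OF assms] by simp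
  then show ?thesis by (simp add: eq_neg_iff_add_eq_0)
qed

subsection \<open>The hypergeometric series\<close>

definition clausen_coeff :: "nat \<Rightarrow> complex" where
  "clausen_coeff k = pochhammer (1 / 2) k ^ 3 / fact k ^ 3"

text \<open>The operator x d/dx applied j times to the hypergeometric function 3F2(1/2, 1/2, 1/2; 1,
  1; x).\<close>

definition clausen_series :: "nat \<Rightarrow> complex \<Rightarrow> complex" where
  "clausen_series j x = (\<Sum>k. of_nat k ^ j * clausen_coeff k * x ^ k)"

lemma clausen_coeff_Suc:
  "of_nat (Suc k) ^ 3 * clausen_coeff (Suc k) = (of_nat k + 1 / 2) ^ 3 * clausen_coeff k"
proof -
  have "clausen_coeff (Suc k) = pochhammer (1 / 2) k ^ 3 * (1 / 2 + of_nat k) ^ 3 / (of_nat (Suc k) ^ 3 * fact k ^ 3)"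
    by (simp only: clausen_coeff_def pochhammer_Suc fact_Suc power_mult_distrib of_nat_mult of_nat_fact)
  moreover have "(of_nat (Suc k) :: complex) \<noteq> 0" by (rule of_nat_neq_0)
  ultimately show ?thesis by (simp add: clausen_coeff_def add.commute del: of_nat_Suc)
qed

text \<open>Consecutive coefficients have the ratio ((k + 1/2) / (k + 1))^3, which is below
  1.\<close>

lemma norm_clausen_coeff_le: "norm (clausen_coeff k) \<le> 1"
proof (induction k)
  case (Suc k)
  have "(of_nat (Suc k) :: complex) \<noteq> 0" by (rule of_nat_neq_0)
  then have "clausen_coeff (Suc k) = ((of_nat k + 1 / 2) / of_nat (Suc k)) ^ 3 * clausen_coeff k"
    using clausen_coeff_Suc[of k] by (simp add: power_divide field_simps del: of_nat_Suc)
  moreover have "norm ((of_nat k + 1 / 2) / of_nat (Suc k) :: complex) \<le> 1"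
  proof -
    have "norm (of_nat k + 1 / 2 :: complex) \<le> norm (of_nat k :: complex) + norm (1 / 2 :: complex)"
      by (rule norm_triangle_ineq)
    also have "\<dots> \<le> real (Suc k)" by simp
    finally show ?thesis by (simp add: norm_divide del: of_nat_Suc)
  qed
  ultimately show ?case
    using Suc by (simp add: norm_mult norm_power mult_le_one power_le_one)
qed (simp add: clausen_coeff_def)

lemma summable_times_n:
  fixes c :: "nat \<Rightarrow> complex"
  assumes "\<And>x. norm x < 1 \<Longrightarrow> summable (\<lambda>k. c k * x ^ k)" "norm x < 1"
  shows "(\<lambda>k. of_nat k * c k * x ^ k) sums (x * (\<Sum>k. diffs c k * x ^ k))"
proof -
  have "summable (\<lambda>k. diffs c k * x ^ k)"
    using assms by (rule termdiff_converges[rotated])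
  from sums_mult[OF diffs_equiv[OF this], of x]
  have "(\<lambda>k. x * (of_nat k * c k * x ^ (k - Suc 0))) sums (x * (\<Sum>k. diffs c k * x ^ k))" .
  moreover have "x * (of_nat k * c k * x ^ (k - Suc 0)) = of_nat k * c k * x ^ k" for k
    by (cases k) auto
  ultimately show ?thesis by simp
qed

lemma clausen_series_summable:
  "norm x < 1 \<Longrightarrow> summable (\<lambda>k. of_nat k ^ j * clausen_coeff k * x ^ k)"
proof (induction j arbitrary: x)
  case 0
  have "summable (\<lambda>k. norm x ^ k)" using 0 by (simp add: summable_geometric)
  then show ?case
    by (rule summable_comparison_test'[where N = 0])
       (auto simp: norm_mult norm_power norm_clausen_coeff_le intro!: mult_left_le_one_le)
next
  case (Suc j)
  from sums_summable[OF summable_times_n[OF Suc.IH Suc.prems]]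
  show ?case by (simp add: mult.assoc)
qed

lemma clausen_series_sums:
  "norm x < 1 \<Longrightarrow> (\<lambda>k. of_nat k ^ j * clausen_coeff k * x ^ k) sums clausen_series j x"
  unfolding clausen_series_def by (intro summable_sums clausen_series_summable)

lemma euler_deriv_clausen_series:
  assumes "norm x < 1"
  shows "euler_deriv (clausen_series j) (clausen_series (Suc j) x) x"
proof -
  let ?c = "\<lambda>k. of_nat k ^ j * clausen_coeff k"
  have "(\<lambda>k. of_nat k * ?c k * x ^ k) sums (x * (\<Sum>k. diffs ?c k * x ^ k))"
    by (rule summable_times_n[OF clausen_series_summable assms])
  then have "clausen_series (Suc j) x = x * (\<Sum>k. diffs ?c k * x ^ k)"
    unfolding clausen_series_def by (simp add: sums_iff mult.assoc)
  moreover have "(clausen_series j has_field_derivative (\<Sum>k. diffs ?c k * x ^ k)) (at x)"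
    unfolding clausen_series_def[abs_def] by (rule termdiffs_strong'[OF clausen_series_summable assms])
  ultimately show ?thesis unfolding euler_deriv_def by blast
qed

lemma clausen_series_0: "clausen_series j 0 = (if j = 0 then 1 else 0)"
proof -
  have "clausen_series j 0 = 0 ^ j * clausen_coeff 0"
    unfolding clausen_series_def by (subst suminf_finite[of "{0}"]) auto
  then show ?thesis by (simp add: clausen_coeff_def power_0_left)
qed

text \<open>With D = x d/dx and H = \<open>clausen_series 0\<close>, the coefficient recurrence says
  D^3 H = x (D + 1/2)^3 H; the factors 3/2, 3/4 and 1/8 come from the binomial expansion.\<close>

lemma clausen_series_ode:
  assumes "norm x < 1"
  shows "clausen_series 3 x = x * (clausen_series 3 x + 3 / 2 * clausen_series 2 x
    + 3 / 4 * clausen_series 1 x + 1 / 8 * clausen_series 0 x)"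
proof -
  note s = clausen_series_sums[OF assms]
  \<comment> \<open>The factor k^3 kills the term k = 0, so shifting the index leaves the sum
    unchanged.\<close>
  have "(\<lambda>k. of_nat (Suc k) ^ 3 * clausen_coeff (Suc k) * x ^ Suc k) sums clausen_series 3 x"
    by (rule iffD2[OF sums_Suc_iff]) (use s[of 3] in simp)
  moreover have "(\<lambda>k. x * (of_nat k ^ 3 * clausen_coeff k * x ^ k + 3 / 2 * (of_nat k ^ 2 * clausen_coeff k * x ^ k)
        + 3 / 4 * (of_nat k ^ 1 * clausen_coeff k * x ^ k) + 1 / 8 * (of_nat k ^ 0 * clausen_coeff k * x ^ k)))
     sums (x * (clausen_series 3 x + 3 / 2 * clausen_series 2 x + 3 / 4 * clausen_series 1 x + 1 / 8 * clausen_series 0 x))"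
    by (intro sums_mult sums_add s)
  then have "(\<lambda>k. of_nat (Suc k) ^ 3 * clausen_coeff (Suc k) * x ^ Suc k) sums
     (x * (clausen_series 3 x + 3 / 2 * clausen_series 2 x + 3 / 4 * clausen_series 1 x + 1 / 8 * clausen_series 0 x))"
  proof (rule back_subst[where P = "\<lambda>f. f sums _"], intro ext)
    show "x * (of_nat k ^ 3 * clausen_coeff k * x ^ k + 3 / 2 * (of_nat k ^ 2 * clausen_coeff k * x ^ k)
        + 3 / 4 * (of_nat k ^ 1 * clausen_coeff k * x ^ k) + 1 / 8 * (of_nat k ^ 0 * clausen_coeff k * x ^ k))
      = of_nat (Suc k) ^ 3 * clausen_coeff (Suc k) * x ^ Suc k" for k
      unfolding clausen_coeff_Suc by (simp add: power3_eq_cube power2_eq_square field_simps)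
  qed
  ultimately show ?thesis by (rule sums_unique2)
qed


text \<open>The functions \<open>T0\<close>, \<open>T1\<close>, \<open>T2\<close> form a chain of
  Euler derivatives whose last derivative vanishes by the hypergeometric equation. Their values 1,
  0, 0 at the origin then determine them from \<open>T2\<close> downwards.\<close>

lemma theta3_power4_eq_clausen_series:
  assumes "q \<in> small_disc"
  shows "clausen_series 0 (4 * theta_lam q * (1 - theta_lam q)) = theta3 q ^ 4"
proof -
  define L Z p w where defs: "L = theta_lam" "Z = (\<lambda>q. (theta3 q)\<^sup>2)" "p = theta_p" "w = theta_w"
  define X where "X = (\<lambda>q. 4 * L q * (1 - L q))"
  define Y where "Y = (\<lambda>j q. clausen_series j (X q))"
  define a where "a = (\<lambda>q. 1 - 2 * L q)"
  \<comment> \<open>The first and second Euler derivatives of \<open>T0\<close> are written out in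
    advance, already simplified by w Z = 1 and a^2 = 1 - X.\<close>
  define T2 where "T2 = (\<lambda>q. (1 - X q) * (Z q * Z q) * Y 2 q - 1 / 2 * X q * (Z q * Z q) * Y 1 q
      + 2 * a q * Z q * p q * Y 1 q + 2 * Y 0 q * (p q * p q) - 1 / 8 * Y 0 q * X q * (Z q * Z q))"
  define T1 where "T1 = (\<lambda>q. a q * Y 1 q + 2 * Y 0 q * (w q * p q))"
  define T0 where "T0 = (\<lambda>q. Y 0 q * (w q * w q))"
  have wZ: "w q * Z q = 1" if "q \<in> small_disc" for q
    using theta3_nonzero[OF that] by (simp add: defs theta_w_def)
  have a2: "a q * a q = 1 - X q" for q by (simp add: a_def X_def algebra_simps)
  have dL: "euler_deriv L (L q * (1 - L q) * (Z q * Z q)) q" if "q \<in> small_disc" for q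
    using euler_deriv_lam[OF that] by (simp add: defs mult.assoc)
  have dw: "euler_deriv w (p q) q" if "q \<in> small_disc" for q
    using euler_deriv_w[OF that] by (simp add: defs)
  have dZ: "euler_deriv Z (- Z q * Z q * p q) q" if "q \<in> small_disc" for q
    using euler_deriv_theta3_square[OF that] by (simp add: defs)
  have dp: "euler_deriv p (- 1 / 16 * X q * (Z q * Z q * Z q)) q" if "q \<in> small_disc" for q
    using euler_deriv_holomorphic[OF theta_p_holomorphic that] euler_p[OF that]
    by (simp add: defs X_def flip: power_add)
  have dX: "euler_deriv X (X q * a q * (Z q * Z q)) q" if "q \<in> small_disc" for q
    unfolding X_def
    by (rule euler_deriv_cong, (rule euler_deriv_intros dL that)+) (simp add: a_def algebra_simps)
  have da: "euler_deriv a (- 1 / 2 * X q * (Z q * Z q)) q" if "q \<in> small_disc" for q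
    unfolding a_def
    by (rule euler_deriv_cong, (rule euler_deriv_intros dL that)+) (simp add: X_def algebra_simps)
  have Xs: "norm (X q) < 1" if "q \<in> small_disc" for q
    using clausen_argument_bound[OF that] by (simp add: X_def defs)
  \<comment> \<open>The Euler derivative of X contains the factor X, which combines with the
    derivative of the series into \<open>Y (Suc j)\<close>. This avoids dividing by X, which
    vanishes at the origin.\<close>
  have dY: "euler_deriv (Y j) (a q * (Z q * Z q) * Y (Suc j) q) q" if q: "q \<in> small_disc" for j q
  proof -
    obtain D where D: "(X has_field_derivative D) (at q)" "X q * a q * (Z q * Z q) = q * D"
      using dX[OF q] unfolding euler_deriv_def by auto
    obtain E where E: "(clausen_series j has_field_derivative E) (at (X q))" "Y (Suc j) q = X q * E"
      using euler_deriv_clausen_series[OF Xs[OF q], of j] unfolding euler_deriv_def Y_def by auto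
    have "(Y j has_field_derivative E * D) (at q)"
      unfolding Y_def by (rule DERIV_chain2[OF E(1) D(1)])
    moreover have "a q * (Z q * Z q) * Y (Suc j) q = q * (E * D)"
    proof -
      have "a q * (Z q * Z q) * Y (Suc j) q = E * (X q * a q * (Z q * Z q))"
        unfolding E(2) by (simp add: mult_ac)
      then show ?thesis unfolding D(2) by (simp add: mult_ac)
    qed
    ultimately show ?thesis unfolding euler_deriv_def by blast
  qed
  have dY0: "euler_deriv (Y 0) (a q * (Z q * Z q) * Y 1 q) q"
    and dY1: "euler_deriv (Y 1) (a q * (Z q * Z q) * Y 2 q) q"
    and dY2: "euler_deriv (Y 2) (a q * (Z q * Z q) * Y 3 q) q" if "q \<in> small_disc" for q
    using dY[OF that, of 0] dY[OF that, of 1] dY[OF that, of 2] by (simp_all add: eval_nat_numeral)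
  have ode: "Y 3 q = X q * (Y 3 q + 3 / 2 * Y 2 q + 3 / 4 * Y 1 q + 1 / 8 * Y 0 q)" if "q \<in> small_disc" for q
    unfolding Y_def by (rule clausen_series_ode[OF Xs[OF that]])
  have T0: "euler_deriv T0 (T1 q) q" if q: "q \<in> small_disc" for q
  proof -
    have "a q * (Z q * Z q) * Y 1 q * (w q * w q) + Y 0 q * (p q * w q + w q * p q)
        = a q * Y 1 q * (w q * Z q) * (w q * Z q) + 2 * Y 0 q * (w q * p q)"
      by (simp add: algebra_simps)
    also have "\<dots> = T1 q" by (simp add: wZ[OF q] T1_def)
    finally show ?thesis
      unfolding T0_def by (intro euler_deriv_cong[OF euler_deriv_mult[OF dY0 euler_deriv_mult[OF dw dw]]] q)
  qed
  have T1: "euler_deriv T1 (T2 q) q" if q: "q \<in> small_disc" for q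
  proof -
    let ?d = "- 1 / 2 * X q * (Z q * Z q) * Y 1 q + a q * (a q * (Z q * Z q) * Y 2 q)
       + ((0 * Y 0 q + 2 * (a q * (Z q * Z q) * Y 1 q)) * (w q * p q)
       + 2 * Y 0 q * (p q * p q + w q * (- 1 / 16 * X q * (Z q * Z q * Z q))))"
    have "?d = (a q * a q) * (Z q * Z q) * Y 2 q - 1 / 2 * X q * (Z q * Z q) * Y 1 q
       + 2 * a q * Z q * (w q * Z q) * p q * Y 1 q + 2 * Y 0 q * (p q * p q) - 1 / 8 * Y 0 q * X q * (Z q * Z q) * (w q * Z q)"
      by (simp add: algebra_simps)
    also have "\<dots> = T2 q" by (simp add: wZ[OF q] a2 T2_def)
    finally have "?d = T2 q" .
    moreover have "euler_deriv T1 ?d q"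
      unfolding T1_def by (intro euler_deriv_intros dY0 dY1 dw da dp q)
    ultimately show ?thesis by simp
  qed
  have T2: "euler_deriv T2 0 q" if q: "q \<in> small_disc" for q
  proof -
    let ?Z = "Z q" and ?X = "X q" and ?a = "a q" and ?p = "p q"
    let ?dX = "?X * ?a * (?Z * ?Z)" and ?dZ = "- ?Z * ?Z * ?p" and ?da = "- 1 / 2 * ?X * (?Z * ?Z)"
      and ?dp = "- 1 / 16 * ?X * (?Z * ?Z * ?Z)"
    let ?dZ2 = "?dZ * ?Z + ?Z * ?dZ"
    let ?d0 = "?a * (?Z * ?Z) * Y 1 q" and ?d1 = "?a * (?Z * ?Z) * Y 2 q" and ?d2 = "?a * (?Z * ?Z) * Y 3 q"
    let ?t1 = "((0 - ?dX) * (?Z * ?Z) + (1 - ?X) * ?dZ2) * Y 2 q + (1 - ?X) * (?Z * ?Z) * ?d2"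
    let ?t2 = "((0 * ?X + 1 / 2 * ?dX) * (?Z * ?Z) + 1 / 2 * ?X * ?dZ2) * Y 1 q + 1 / 2 * ?X * (?Z * ?Z) * ?d1"
    let ?t3 = "(((0 * ?a + 2 * ?da) * ?Z + 2 * ?a * ?dZ) * ?p + 2 * ?a * ?Z * ?dp) * Y 1 q + 2 * ?a * ?Z * ?p * ?d1"
    let ?t4 = "(0 * Y 0 q + 2 * ?d0) * (?p * ?p) + 2 * Y 0 q * (?dp * ?p + ?p * ?dp)"
    let ?t5 = "((0 * Y 0 q + 1 / 8 * ?d0) * ?X + 1 / 8 * Y 0 q * ?dX) * (?Z * ?Z) + 1 / 8 * Y 0 q * ?X * ?dZ2"
    have "euler_deriv T2 (?t1 - ?t2 + ?t3 + ?t4 - ?t5) q"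
      unfolding T2_def by (intro euler_deriv_intros dX dY0 dY1 dY2 dZ da dp q)
    \<comment> \<open>Everything collects into a multiple of the hypergeometric equation and a
      multiple of a^2 - (1 - X), both zero.\<close>
    moreover have "?t1 - ?t2 + ?t3 + ?t4 - ?t5 =
        ?a * ?Z ^ 4 * (Y 3 q - ?X * (Y 3 q + 3 / 2 * Y 2 q + 3 / 4 * Y 1 q + 1 / 8 * Y 0 q))
        + 2 * ?Z ^ 3 * ?p * Y 2 q * (?a * ?a - (1 - ?X))"
      by (simp add: power4_eq_xxxx power3_eq_cube field_simps)
    moreover have "\<dots> = 0" using ode[OF q] by (simp add: a2)
    ultimately show ?thesis by simp
  qed
  have p0: "p 0 = 0" by (simp add: defs theta_p_def)
  have X0: "X 0 = 0" by (simp add: X_def defs theta_lam_def)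
  have Y0: "Y 0 0 = 1" "Y 1 0 = 0" "Y 2 0 = 0" by (simp_all add: Y_def X0 clausen_series_0)
  have "T2 q = 0" if "q \<in> small_disc" for q
    using euler_deriv_zero_imp_constant[OF T2 that] by (simp add: T2_def p0 Y0 X0)
  then have "euler_deriv T1 0 q" if "q \<in> small_disc" for q
    using T1 that by metis
  then have "T1 q = 0" if "q \<in> small_disc" for q
    using euler_deriv_zero_imp_constant[of "1 / 100" T1 q] that by (simp add: T1_def p0 Y0 del: One_nat_def)
  then have "euler_deriv T0 0 q" if "q \<in> small_disc" for q
    using T0 that by metis
  then have "T0 q = 1"
    using euler_deriv_zero_imp_constant[of "1 / 100" T0 q] assms by (simp add: T0_def Y0 defs theta_w_def theta3_0)
  then show ?thesis
    using theta3_nonzero[OF assms] by (simp add: T0_def Y_def X_def defs theta_w_def field_simps)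
qed

text \<open>Take Euler derivatives on both sides of the identity for the fourth power of
  \<open>theta3\<close> and cancel \<open>theta3 q ^ 3\<close>.\<close>

lemma clausen_series_1_eq:
  assumes "q \<in> small_disc"
  shows "(1 - 2 * theta_lam q) * clausen_series 1 (4 * theta_lam q * (1 - theta_lam q)) * theta3 q = 4 * (q * deriv theta3 q)"
proof -
  let ?t = "theta3 q" and ?l = "theta_lam q" and ?d = "q * deriv theta3 q"
  let ?dl = "?l * (1 - ?l) * (?t\<^sup>2 * ?t\<^sup>2)"
  have dl: "euler_deriv theta_lam ?dl q" using euler_deriv_lam[OF assms] by (simp add: mult.assoc)
  have dX: "euler_deriv (\<lambda>q. 4 * theta_lam q * (1 - theta_lam q)) ((0 * ?l + 4 * ?dl) * (1 - ?l) + 4 * ?l * (0 - ?dl)) q"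
    by (intro euler_deriv_intros dl)
  then obtain D where D: "((\<lambda>q. 4 * theta_lam q * (1 - theta_lam q)) has_field_derivative D) (at q)"
      "4 * ?l * (1 - ?l) * ((1 - 2 * ?l) * (?t\<^sup>2 * ?t\<^sup>2)) = q * D"
    unfolding euler_deriv_def by (auto simp: algebra_simps)
  obtain E where E: "(clausen_series 0 has_field_derivative E) (at (4 * ?l * (1 - ?l)))"
     "clausen_series 1 (4 * ?l * (1 - ?l)) = 4 * ?l * (1 - ?l) * E"
    using euler_deriv_clausen_series[OF clausen_argument_bound[OF assms], of 0] unfolding euler_deriv_def by auto
  have "q * (E * D) = (1 - 2 * ?l) * (?t\<^sup>2 * ?t\<^sup>2) * clausen_series 1 (4 * ?l * (1 - ?l))"
  proof -
    have "q * (E * D) = E * (4 * ?l * (1 - ?l) * ((1 - 2 * ?l) * (?t\<^sup>2 * ?t\<^sup>2)))" unfolding D(2) by (simp add: mult_ac)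
    then show ?thesis unfolding E(2) by (simp add: mult_ac)
  qed
  then have "euler_deriv (\<lambda>q. clausen_series 0 (4 * theta_lam q * (1 - theta_lam q)))
     ((1 - 2 * ?l) * (?t\<^sup>2 * ?t\<^sup>2) * clausen_series 1 (4 * ?l * (1 - ?l))) q"
    using DERIV_chain2[OF E(1) D(1)] unfolding euler_deriv_def by metis
  then have l: "euler_deriv (\<lambda>q. (theta3 q * theta3 q) * (theta3 q * theta3 q))
     ((1 - 2 * ?l) * (?t\<^sup>2 * ?t\<^sup>2) * clausen_series 1 (4 * ?l * (1 - ?l))) q"
    by (rule euler_deriv_transform[OF _ assms], subst theta3_power4_eq_clausen_series)
       (auto simp: power4_eq_xxxx mult.assoc)
  have d: "euler_deriv theta3 ?d q"
    by (rule euler_deriv_holomorphic[OF theta3_holomorphic_small assms])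
  have "euler_deriv (\<lambda>q. (theta3 q * theta3 q) * (theta3 q * theta3 q))
     ((?d * ?t + ?t * ?d) * (?t * ?t) + (?t * ?t) * (?d * ?t + ?t * ?d)) q"
    by (intro euler_deriv_intros d)
  from euler_deriv_unique[OF l this]
  have "?t ^ 3 * ((1 - 2 * ?l) * clausen_series 1 (4 * ?l * (1 - ?l)) * ?t) = ?t ^ 3 * (4 * ?d)"
    by (simp add: power2_eq_square power3_eq_cube algebra_simps)
  then show ?thesis using theta3_nonzero[OF assms] by simp
qed

lemma theta_alpha_eq_lam: "q \<noteq> 0 \<Longrightarrow> theta_alpha q = theta_lam q"
  by (simp add: theta_alpha_def theta_lam_def theta2_power4 power_divide)

subsection \<open>Inversion of \<open>theta3\<close>\<close>

text \<open>The symmetry under x -> 1 - x makes d a continuous function of cos (2 pi x), hence a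
  uniform limit of polynomials in this cosine. Orthogonality to these polynomials forces the
  integral of d^2 to vanish.\<close>

lemma continuous_even_orthogonal_cos_imp_zero:
  fixes d :: "real \<Rightarrow> real"
  assumes cont: "continuous_on {0..1} d" and sym: "\<And>x. x \<in> {0..1} \<Longrightarrow> d (1 - x) = d x"
    and orth: "\<And>j::int. integral {0..1} (\<lambda>x. d x * cos (2 * pi * of_int j * x)) = 0"
    and x: "x \<in> {0..1}"
  shows "d x = 0"
proof -
  have ci: "continuous_on {0..1} (\<lambda>x. d x * cos (2 * pi * x) ^ i * cos (2 * pi * of_int j * x))" for i and j :: int
    by (intro continuous_intros cont)
  note int = integrable_continuous_real[OF ci]
  \<comment> \<open>Multiplying by one more cosine averages the frequencies j + 1 and j - 1, so the
    induction on the power keeps j arbitrary.\<close>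
  have orth': "integral {0..1} (\<lambda>x. d x * cos (2 * pi * x) ^ i * cos (2 * pi * of_int j * x)) = 0" for i and j :: int
  proof (induction i arbitrary: j)
    case (Suc i)
    have "d x * cos (2 * pi * x) ^ Suc i * cos (2 * pi * of_int j * x)
        = 1 / 2 * (d x * cos (2 * pi * x) ^ i * cos (2 * pi * of_int (j + 1) * x))
        + 1 / 2 * (d x * cos (2 * pi * x) ^ i * cos (2 * pi * of_int (j - 1) * x))" for x
    proof -
      have "cos (2 * pi * x) * cos (2 * pi * of_int j * x)
          = (cos (2 * pi * of_int (j - 1) * x) + cos (2 * pi * of_int (j + 1) * x)) / 2"
        unfolding cos_times_cos by (subst cos_minus[symmetric]) (simp add: algebra_simps)
      then have "d x * cos (2 * pi * x) ^ i * (cos (2 * pi * x) * cos (2 * pi * of_int j * x))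
          = d x * cos (2 * pi * x) ^ i * ((cos (2 * pi * of_int (j - 1) * x) + cos (2 * pi * of_int (j + 1) * x)) / 2)"
        by simp
      then show ?thesis by (simp add: field_simps)
    qed
    then have "integral {0..1} (\<lambda>x. d x * cos (2 * pi * x) ^ Suc i * cos (2 * pi * of_int j * x))
       = integral {0..1} (\<lambda>x. 1 / 2 * (d x * cos (2 * pi * x) ^ i * cos (2 * pi * of_int (j + 1) * x))
        + 1 / 2 * (d x * cos (2 * pi * x) ^ i * cos (2 * pi * of_int (j - 1) * x)))"
      by simp
    also have "\<dots> = 0"
      by (subst integral_add) (use int Suc.IH in \<open>auto simp del: of_int_add of_int_diff intro!: integrable_on_cmult_left\<close>)
    finally show ?case .
  qed (use orth in simp)
  \<comment> \<open>\<open>D\<close> is d as a function of y = cos (2 pi x). The inverse cosine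
    reaches only x up to 1/2; the symmetry covers the other half.\<close>
  define D where "D = (\<lambda>y. d (arccos y / (2 * pi)))"
  have contD: "continuous_on {-1..1} D"
    unfolding D_def
  proof (rule continuous_on_compose2[OF cont])
    show "continuous_on {-1..1} (\<lambda>y. arccos y / (2 * pi))"
      by (intro continuous_intros) auto
    have "arccos y / (2 * pi) \<le> 1" "0 \<le> arccos y / (2 * pi)" if "y \<in> {-1..1}" for y
      using arccos_lbound[of y] arccos_ubound[of y] that pi_gt_zero by (auto simp: divide_simps)
    then show "(\<lambda>y. arccos y / (2 * pi)) ` {-1..1} \<subseteq> {0..1}" by auto
  qed
  have D: "D (cos (2 * pi * y)) = d y" if y: "y \<in> {0..1}" for y
  proof (cases "y \<le> 1 / 2")
    case True
    then have "arccos (cos (2 * pi * y)) = 2 * pi * y" using y by (intro arccos_cos) auto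
    then show ?thesis by (simp add: D_def)
  next
    case False
    have "cos (2 * pi * y) = cos (2 * pi * (1 - y))"
      using cos_2pi_minus[of "2 * pi * y"] by (simp add: algebra_simps)
    moreover have "arccos (cos (2 * pi * (1 - y))) = 2 * pi * (1 - y)"
      using False y by (intro arccos_cos) auto
    ultimately show ?thesis using sym[OF y] by (simp add: D_def)
  qed
  have cont2: "continuous_on {0..1} (\<lambda>x. d x * d x)" by (intro continuous_intros cont)
  define C where "C = integral {0..1} (\<lambda>x. \<bar>d x\<bar>)"
  \<comment> \<open>With g a polynomial within e of \<open>D\<close>, the integral of d^2 equals
    that of d (d - g), which is at most e times the integral of |d|.\<close>
  have small: "integral {0..1} (\<lambda>x. d x * d x) \<le> e * C" if "e > 0" for e
  proof -
    obtain g where g: "real_polynomial_function g" and ge: "\<And>y. y \<in> {-1..1} \<Longrightarrow> \<bar>D y - g y\<bar> < e"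
      using Stone_Weierstrass_real_polynomial_function[OF compact_Icc contD \<open>e > 0\<close>] by blast
    obtain a n where gs: "g = (\<lambda>y. \<Sum>i\<le>n. a i * y ^ i)"
      using g real_polynomial_function_iff_sum by auto
    let ?g = "\<lambda>x. g (cos (2 * pi * x))"
    have contg: "continuous_on {0..1} ?g" unfolding gs by (intro continuous_intros)
    have int0: "(\<lambda>x. d x * cos (2 * pi * x) ^ i) integrable_on {0..1}"
       "integral {0..1} (\<lambda>x. d x * cos (2 * pi * x) ^ i) = 0" for i
      using int[of i 0] orth'[of i 0] by simp_all
    have "integral {0..1} (\<lambda>x. d x * ?g x) = integral {0..1} (\<lambda>x. \<Sum>i\<le>n. a i * (d x * cos (2 * pi * x) ^ i))"
      unfolding gs by (simp add: sum_distrib_left mult_ac)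
    also have "\<dots> = 0"
      by (subst integral_sum) (auto simp: int0 intro!: integrable_on_mult_right)
    finally have "integral {0..1} (\<lambda>x. d x * d x) = integral {0..1} (\<lambda>x. d x * d x) - integral {0..1} (\<lambda>x. d x * ?g x)"
      by simp
    also have "\<dots> = integral {0..1} (\<lambda>x. d x * d x - d x * ?g x)"
      by (rule integral_diff[symmetric]) (intro integrable_continuous_real continuous_intros cont contg)+
    also have "\<dots> \<le> integral {0..1} (\<lambda>x. e * \<bar>d x\<bar>)"
    proof (rule integral_le)
      show "d x * d x - d x * ?g x \<le> e * \<bar>d x\<bar>" if "x \<in> {0..1}" for x
      proof -
        have "\<bar>d x - ?g x\<bar> \<le> e" using ge[of "cos (2 * pi * x)"] D[OF that] by auto
        then have "\<bar>d x\<bar> * \<bar>d x - ?g x\<bar> \<le> \<bar>d x\<bar> * e" by (intro mult_left_mono) auto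
        then have "d x * (d x - ?g x) \<le> e * \<bar>d x\<bar>"
          using abs_ge_self[of "d x * (d x - ?g x)"] by (simp add: abs_mult mult.commute)
        then show ?thesis by (simp add: right_diff_distrib)
      qed
    qed (intro integrable_continuous_real continuous_intros cont contg)+
    also have "\<dots> = e * C" by (simp add: C_def)
    finally show ?thesis .
  qed
  have "integral {0..1} (\<lambda>x. d x * d x) \<le> 0"
  proof (rule tendsto_lowerbound)
    have "((\<lambda>e. e * C) \<longlongrightarrow> 0 * C) (at_right 0)" by (intro tendsto_intros)
    then show "((\<lambda>e. e * C) \<longlongrightarrow> 0) (at_right 0)" by simp
    show "\<forall>\<^sub>F e in at_right 0. integral {0..1} (\<lambda>x. d x * d x) \<le> e * C"
      using small by (auto simp: eventually_at_right_field intro!: exI[of _ 1])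
  qed auto
  moreover have "integral {0..1} (\<lambda>x. d x * d x) \<ge> 0"
    by (rule integral_nonneg[OF integrable_continuous_real[OF cont2]]) auto
  ultimately have "((\<lambda>x. d x * d x) has_integral 0) {0..1}"
    using integrable_integral[OF integrable_continuous_real[OF cont2]] by simp
  then have "d x * d x = 0"
    using has_integral_0_cbox_imp_0[of 0 1 "\<lambda>x. d x * d x" x] cont2 x by auto
  then show ?thesis by simp
qed

text \<open>Rescaling to the standard normal density turns the integral into the real part of its
  characteristic function, exp (- u^2 / 2).\<close>

lemma gaussian_cos_integral:
  fixes t s :: real
  assumes "t > 0"
  shows "integrable lborel (\<lambda>x. exp (- pi * t * x\<^sup>2) * cos (2 * pi * s * x))"
    and "(LINT x|lborel. exp (- pi * t * x\<^sup>2) * cos (2 * pi * s * x)) = exp (- pi * s\<^sup>2 / t) / sqrt t"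
proof -
  \<comment> \<open>The scale c satisfies (c x)^2 / 2 = pi t x^2, and the frequency u satisfies u c
    x = 2 pi s x.\<close>
  define c where "c = sqrt (2 * pi * t)"
  have c: "c > 0" "c\<^sup>2 = 2 * pi * t" using assms by (auto simp: c_def)
  define u where "u = 2 * pi * s / c"
  let ?n = "\<lambda>y. std_normal_density y * cos (u * y)"
  have iN: "integrable lborel ?n"
    by (rule Bochner_Integration.integrable_bound[OF integrable_normal_density[where \<mu> = 0 and \<sigma> = 1]])
       (auto simp: abs_mult intro!: mult_left_le AE_I2)
  have "(LINT y|lborel. ?n y) = exp (- u\<^sup>2 / 2)"
  proof -
    interpret prob_space std_normal_distribution by (rule prob_space_normal_density) simp
    have 1: "integrable std_normal_distribution (\<lambda>x. iexp (u * x))"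
      by (rule integrable_iexp) auto
    have "(LINT x|std_normal_distribution. Re (iexp (u * x))) = Re (char std_normal_distribution u)"
      unfolding char_def using 1 by (rule integral_Re)
    also have "(LINT x|std_normal_distribution. Re (iexp (u * x))) = (LINT x|std_normal_distribution. cos (u * x))"
      by (simp add: Re_exp)
    also have "\<dots> = (LINT y|lborel. ?n y)"
      by (subst integral_density) auto
    finally show ?thesis by (simp add: char_std_normal_distribution)
  qed
  moreover have n: "?n (0 + c * x) = 1 / sqrt (2 * pi) * (exp (- pi * t * x\<^sup>2) * cos (2 * pi * s * x))" for x
    using c by (simp add: std_normal_density_def power_mult_distrib u_def mult.assoc)
  moreover have "(LINT y|lborel. ?n y) = \<bar>c\<bar> *\<^sub>R (LINT x|lborel. ?n (0 + c * x))"
    using c by (intro lborel_integral_real_affine) auto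
  ultimately have "exp (- u\<^sup>2 / 2) = c * (1 / sqrt (2 * pi) * (LINT x|lborel. exp (- pi * t * x\<^sup>2) * cos (2 * pi * s * x)))"
    using c by simp
  moreover have "c = sqrt (2 * pi) * sqrt t" by (simp add: c_def real_sqrt_mult)
  moreover have "u\<^sup>2 / 2 = pi * s\<^sup>2 / t"
    unfolding u_def power_divide c(2) using assms by (simp add: power_mult_distrib field_simps power2_eq_square)
  ultimately show "(LINT x|lborel. exp (- pi * t * x\<^sup>2) * cos (2 * pi * s * x)) = exp (- pi * s\<^sup>2 / t) / sqrt t"
    using assms by (simp add: field_simps)
  have "integrable lborel (\<lambda>x. ?n (0 + c * x))"
    using c by (intro lborel_integrable_real_affine iN) auto
  then have "integrable lborel (\<lambda>x. sqrt (2 * pi) * ?n (0 + c * x))" by (rule integrable_mult_right)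
  then show "integrable lborel (\<lambda>x. exp (- pi * t * x\<^sup>2) * cos (2 * pi * s * x))"
    unfolding n by simp
qed

section \<open>Term-by-term integration on the unit interval\<close>

lemma
  fixes f :: "int \<Rightarrow> real \<Rightarrow> real"
  assumes r: "0 \<le> r" "r < 1"
    and c: "\<And>n. continuous_on {0..1} (f n)"
    and b: "\<And>n x. x \<in> {0..1} \<Longrightarrow> \<bar>f n x\<bar> \<le> r ^ nat (\<bar>n\<bar> - 1)"
  shows unit_interval_series_continuous: "continuous_on {0..1} (\<lambda>x. \<Sum>\<^sub>\<infinity>n. f n x)"
    and unit_interval_series_integral:
      "((\<lambda>n. integral {0..1} (f n)) has_sum integral {0..1} (\<lambda>x. \<Sum>\<^sub>\<infinity>n. f n x)) UNIV"
proof -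
  have u: "uniform_limit {0..1} (\<lambda>X x. \<Sum>n\<in>X. f n x) (\<lambda>x. \<Sum>\<^sub>\<infinity>n. f n x) (finite_subsets_at_top UNIV)"
    using b by (intro Weierstrass_m_test_general[OF _ summable_on_int_geometric[OF r]]) auto
  have cs: "continuous_on {0..1} (\<lambda>x. \<Sum>n\<in>X. f n x)" for X
    by (intro continuous_intros c)
  show "continuous_on {0..1} (\<lambda>x. \<Sum>\<^sub>\<infinity>n. f n x)"
    by (rule uniform_limit_theorem[OF _ u]) (use cs in auto)
  obtain I J where I: "\<And>X. ((\<lambda>x. \<Sum>n\<in>X. f n x) has_integral I X) {0..1}"
    and J: "((\<lambda>x. \<Sum>\<^sub>\<infinity>n. f n x) has_integral J) {0..1}" "(I \<longlongrightarrow> J) (finite_subsets_at_top UNIV)"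
    by (rule uniform_limit_integral[OF u cs]) auto
  have "I X = (\<Sum>n\<in>X. integral {0..1} (f n))" if "finite X" for X
    using integral_unique[OF I[of X]] integrable_continuous_real[OF c] that by (simp add: integral_sum)
  with J have "((\<lambda>X. \<Sum>n\<in>X. integral {0..1} (f n)) \<longlongrightarrow> J) (finite_subsets_at_top UNIV)"
    by (intro Lim_transform_eventually[OF J(2)]) auto
  moreover have "J = integral {0..1} (\<lambda>x. \<Sum>\<^sub>\<infinity>n. f n x)" using J(1) by (simp add: integral_unique)
  ultimately show "((\<lambda>n. integral {0..1} (f n)) has_sum integral {0..1} (\<lambda>x. \<Sum>\<^sub>\<infinity>n. f n x)) UNIV"
    by (simp add: has_sum_def)
qed

lemma integral_cos_of_int:
  "integral {0..1} (\<lambda>x. cos (2 * pi * of_int m * x)) = (if m = 0 then 1 else 0)" for m :: int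
proof (cases "m = 0")
  case False
  have "((\<lambda>x. cos (2 * pi * of_int m * x)) has_integral
     (sin (2 * pi * of_int m * 1) / (2 * pi * of_int m) - sin (2 * pi * of_int m * 0) / (2 * pi * of_int m))) {0..1}"
    using False
    by (intro fundamental_theorem_of_calculus)
       (auto intro!: derivative_eq_intros simp flip: has_real_derivative_iff_has_vector_derivative)
  moreover have "sin (2 * pi * of_int m * 1) = 0" using sin_int_2pin[of m] by simp
  ultimately show ?thesis using False by (simp add: integral_unique)
qed simp

text \<open>The unordered sum is evaluated along the index sets from -M to M - 1, whose partial sums
  are integrals over [-M, M]; these tend to the Lebesgue integral by dominated convergence.\<close>

lemma has_sum_integral_unit_intervals:
  fixes g :: "real \<Rightarrow> real"
  assumes g: "integrable lborel g" "continuous_on UNIV g"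
    and s: "((\<lambda>n::int. integral {of_int n..of_int n + 1} g) has_sum S) UNIV"
  shows "S = (LINT x|lborel. g x)"
proof -
  have int: "g integrable_on {a..b}" for a b
    using g(2) by (intro integrable_continuous_real) (rule continuous_on_subset, auto)
  have part: "(\<Sum>n\<in>{- int M..<int M}. integral {of_int n..of_int n + 1} g) = integral {- real M..real M} g" for M
  proof (induction M)
    case (Suc M)
    have "{- int (Suc M)..<int (Suc M)} = insert (- int M - 1) (insert (int M) {- int M..<int M})" by auto
    then have "(\<Sum>n\<in>{- int (Suc M)..<int (Suc M)}. integral {of_int n..of_int n + 1} g)
       = integral {- real M - 1..- real M} g + (integral {real M..real M + 1} g + integral {- real M..real M} g)"
      using Suc by simp
    also have "\<dots> = integral {- real M - 1..real M + 1} g"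
      using Henstock_Kurzweil_Integration.integral_combine[OF _ _ int, of "- real M" "real M" "real M + 1"]
        Henstock_Kurzweil_Integration.integral_combine[OF _ _ int, of "- real M - 1" "- real M" "real M + 1"] by simp
    also have "- real M - 1 = - real (Suc M)" by simp
    also have "real M + 1 = real (Suc M)" by simp
    finally show ?case .
  qed simp
  \<comment> \<open>Every finite set of integers is eventually contained in these intervals, so they
    compute the limit along all finite subsets.\<close>
  have "filterlim (\<lambda>M. {- int M..<int M}) (finite_subsets_at_top UNIV) sequentially"
    unfolding filterlim_finite_subsets_at_top
  proof (intro allI impI)
    fix X :: "int set" assume X: "finite X \<and> X \<subseteq> UNIV"
    have "bdd_above (abs ` X)" using X by auto
    then obtain K where K: "\<forall>x\<in>X. \<bar>x\<bar> \<le> K" unfolding bdd_above_def by auto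
    show "\<forall>\<^sub>F M in sequentially. finite {- int M..<int M} \<and> X \<subseteq> {- int M..<int M} \<and> {- int M..<int M} \<subseteq> UNIV"
      using eventually_ge_at_top[of "nat (K + 1)"] by eventually_elim (use K in fastforce)
  qed
  with s have "(\<lambda>M. integral {- real M..real M} g) \<longlonglongrightarrow> S"
    unfolding has_sum_def part[symmetric] by (rule filterlim_compose)
  moreover have "(\<lambda>M. integral {- real M..real M} g) \<longlonglongrightarrow> (LINT x|lborel. g x)"
  proof -
    have "(\<lambda>M. LINT x|lborel. indicator {- real M..real M} x * g x) \<longlonglongrightarrow> (LINT x|lborel. g x)"
    proof (rule integral_dominated_convergence)
      show "AE x in lborel. (\<lambda>M. indicator {- real M..real M} x * g x) \<longlonglongrightarrow> g x"
      proof (intro AE_I2 tendsto_eventually)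
        fix x
        show "\<forall>\<^sub>F M in sequentially. indicator {- real M..real M} x * g x = g x"
          using eventually_ge_at_top[of "nat \<lceil>\<bar>x\<bar>\<rceil>"]
          by eventually_elim (auto simp: indicator_def nat_le_iff ceiling_le_iff)
      qed
      show "integrable lborel (\<lambda>x. \<bar>g x\<bar>)" using g(1) by (rule integrable_abs)
    qed (use g(1) in \<open>auto simp: indicator_def intro!: borel_measurable_times borel_measurable_integrable\<close>)
    moreover have "(LINT x|lborel. indicator {- real M..real M} x * g x) = integral {- real M..real M} g" for M
    proof -
      have "set_integrable lborel {- real M..real M} g"
        using g(1) by (rule set_integrable_subset[where A = UNIV, unfolded set_integrable_def, simplified, folded set_integrable_def]) auto
      from set_borel_integral_eq_integral(2)[OF this] show ?thesis
        by (simp add: set_lebesgue_integral_def)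
    qed
    ultimately show ?thesis by simp
  qed
  ultimately show ?thesis by (rule LIMSEQ_unique)
qed


lemma cos_add_int_2pi: "cos (y + 2 * pi * of_int m) = cos y" for y :: real
  by (simp add: cos_add cos_int_2pin sin_int_2pin)

text \<open>For nonzero n put m = |n| - 1. Then |x + n| is at least m on the unit interval, and m is
  at most m^2.\<close>

lemma gaussian_shift_bound:
  fixes t x :: real and n :: int
  assumes "t > 0" "x \<in> {0..1}"
  shows "exp (- pi * t * (x + of_int n)\<^sup>2) \<le> exp (- pi * t) ^ nat (\<bar>n\<bar> - 1)"
proof (cases "n = 0")
  case False
  define m where "m = nat (\<bar>n\<bar> - 1)"
  have m: "real m = \<bar>real_of_int n\<bar> - 1" using False by (simp add: m_def)
  have "real m \<le> \<bar>x + of_int n\<bar>" using m assms(2) by auto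
  then have "(real m)\<^sup>2 \<le> (x + of_int n)\<^sup>2" using abs_le_square_iff[of "real m" "x + of_int n"] by simp
  moreover have "real m \<le> (real m)\<^sup>2" by (cases m) (auto simp: power2_eq_square)
  ultimately have "real m \<le> (x + of_int n)\<^sup>2" by linarith
  then have "pi * t * real m \<le> pi * t * (x + of_int n)\<^sup>2" using assms(1) by (intro mult_left_mono) auto
  then show ?thesis
    unfolding m_def[symmetric] by (simp add: exp_of_nat_mult[symmetric] mult_ac)
qed (use assms in simp)

text \<open>Unfolding: the cosine has period 1, so the nth term integrates over [0, 1] to the
  integral of one Gaussian times the cosine over [n, n + 1], and the pieces fill the line.\<close>

lemma gaussian_fourier_coefficient:
  fixes t :: real and j :: int
  assumes t: "t > 0"
  shows "integral {0..1} (\<lambda>x. (\<Sum>\<^sub>\<infinity>n::int. exp (- pi * t * (x + of_int n)\<^sup>2)) * cos (2 * pi * of_int j * x))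
    = exp (- pi * (of_int j)\<^sup>2 / t) / sqrt t"
proof -
  let ?c = "\<lambda>x. cos (2 * pi * of_int j * x)"
  let ?f = "\<lambda>n x. exp (- pi * t * (x + of_int n)\<^sup>2) * ?c x" and ?g = "\<lambda>x. exp (- pi * t * x\<^sup>2) * ?c x"
  have b: "\<bar>?f n x\<bar> \<le> exp (- pi * t) ^ nat (\<bar>n\<bar> - 1)" if "x \<in> {0..1}" for n :: int and x
  proof -
    have "\<bar>?f n x\<bar> \<le> exp (- pi * t * (x + of_int n)\<^sup>2)" by (simp add: abs_mult mult_left_le)
    then show ?thesis using gaussian_shift_bound[OF t that, of n] by linarith
  qed
  have "((\<lambda>n. integral {0..1} (?f n)) has_sum integral {0..1} (\<lambda>x. \<Sum>\<^sub>\<infinity>n. ?f n x)) UNIV"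
    by (rule unit_interval_series_integral[of "exp (- pi * t)"]) (use t b in \<open>auto intro!: continuous_intros\<close>)
  moreover have "integral {0..1} (?f n) = integral {of_int n..of_int n + 1} ?g" for n :: int
  proof -
    have "?f n x = (?g \<circ> (\<lambda>x. x + of_int n)) x" for x
    proof -
      have "2 * pi * of_int j * (x + of_int n) = 2 * pi * of_int j * x + 2 * pi * of_int (j * n)"
        by (simp add: algebra_simps)
      then show ?thesis by (simp only: cos_add_int_2pi o_def)
    qed
    then have "integral {0..1} (?f n) = integral {0..1} (?g \<circ> (\<lambda>x. x + of_int n))" by presburger
    also have "\<dots> = integral {0 + of_int n..1 + of_int n} ?g"
      by (rule integral_shift) (intro continuous_intros)
    finally show ?thesis by (simp add: add.commute)
  qed
  ultimately have "((\<lambda>n::int. integral {of_int n..of_int n + 1} ?g) has_sum integral {0..1} (\<lambda>x. \<Sum>\<^sub>\<infinity>n. ?f n x)) UNIV"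
    by simp
  then have "integral {0..1} (\<lambda>x. \<Sum>\<^sub>\<infinity>n. ?f n x) = (LINT x|lborel. ?g x)"
    using gaussian_cos_integral(1)[OF t] by (intro has_sum_integral_unit_intervals) (auto intro!: continuous_intros)
  then show ?thesis
    unfolding gaussian_cos_integral(2)[OF t] by (simp add: infsum_cmult_left')
qed

text \<open>Only k = j and k = -j survive, each with half its coefficient; evenness of e combines
  them to e j. The two half terms also add up correctly when j = 0.\<close>

lemma cos_series_coefficient:
  fixes r :: real and j :: int and e :: "int \<Rightarrow> real"
  assumes r: "0 \<le> r" "r < 1" and e: "\<And>k. \<bar>e k\<bar> \<le> r ^ nat (\<bar>k\<bar> - 1)" and sym: "\<And>k. e (- k) = e k"
  shows "integral {0..1} (\<lambda>x. (\<Sum>\<^sub>\<infinity>k. e k * cos (2 * pi * of_int k * x)) * cos (2 * pi * of_int j * x)) = e j"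
proof -
  let ?c = "\<lambda>k x. cos (2 * pi * of_int k * x)"
  let ?f = "\<lambda>k x. e k * ?c k x * ?c j x"
  have b: "\<bar>?f k x\<bar> \<le> r ^ nat (\<bar>k\<bar> - 1)" for k x
  proof -
    have "\<bar>?f k x\<bar> \<le> \<bar>e k\<bar>" by (simp add: abs_mult mult_left_le mult_le_one mult.assoc)
    then show ?thesis using e[of k] by linarith
  qed
  have "((\<lambda>k. integral {0..1} (?f k)) has_sum integral {0..1} (\<lambda>x. \<Sum>\<^sub>\<infinity>k. ?f k x)) UNIV"
    by (rule unit_interval_series_integral[OF r]) (use b in \<open>auto intro!: continuous_intros\<close>)
  moreover have "integral {0..1} (?f k) = (if k = j then e k / 2 else 0) + (if k = - j then e k / 2 else 0)" for k
  proof -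
    have "?f k x = e k / 2 * ?c (k - j) x + e k / 2 * ?c (k + j) x" for x
    proof -
      have "?c k x * ?c j x = (?c (k - j) x + ?c (k + j) x) / 2"
        unfolding cos_times_cos by (simp add: algebra_simps)
      then have "e k * (?c k x * ?c j x) = e k * ((?c (k - j) x + ?c (k + j) x) / 2)" by simp
      then show ?thesis by (simp only: mult.assoc) (simp add: distrib_left add_divide_distrib)
    qed
    then have "integral {0..1} (?f k) = integral {0..1} (\<lambda>x. e k / 2 * ?c (k - j) x + e k / 2 * ?c (k + j) x)"
      by presburger
    also have "\<dots> = e k / 2 * integral {0..1} (?c (k - j)) + e k / 2 * integral {0..1} (?c (k + j))"
      by (subst integral_add) (auto intro!: integrable_continuous_real continuous_intros)
    also have "\<dots> = (if k = j then e k / 2 else 0) + (if k = - j then e k / 2 else 0)"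
      unfolding integral_cos_of_int by auto
    finally show ?thesis .
  qed
  ultimately have "((\<lambda>k. (if k = j then e k / 2 else 0) + (if k = - j then e k / 2 else 0)) has_sum integral {0..1} (\<lambda>x. \<Sum>\<^sub>\<infinity>k. ?f k x)) UNIV"
    by simp
  moreover have "((\<lambda>k. (if k = j then e k / 2 else 0) + (if k = - j then e k / 2 else 0)) has_sum (e j / 2 + e (- j) / 2)) UNIV"
    by (intro has_sum_add has_sum_finite_neutralI[of "{j}"] has_sum_finite_neutralI[of "{- j}"]) auto
  ultimately have "integral {0..1} (\<lambda>x. \<Sum>\<^sub>\<infinity>k. ?f k x) = e j / 2 + e (- j) / 2" by (rule has_sum_unique)
  then show ?thesis by (simp add: sym infsum_cmult_left')
qed

text \<open>Poisson summation. The periodised Gaussian \<open>F\<close> and the cosine series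
  \<open>P\<close> divided by sqrt t are continuous, symmetric under x -> 1 - x, and have equal
  cosine coefficients, so they agree; the claim is their equality at x = 0.\<close>

theorem gaussian_sum_inversion:
  fixes t :: real
  assumes t: "t > 0"
  shows "(\<Sum>\<^sub>\<infinity>n::int. exp (- pi * t * (of_int n)\<^sup>2)) = (\<Sum>\<^sub>\<infinity>n::int. exp (- pi * (of_int n)\<^sup>2 / t)) / sqrt t"
proof -
  define e where "e = (\<lambda>k::int. exp (- pi * (of_int k)\<^sup>2 / t))"
  define F where "F = (\<lambda>x. \<Sum>\<^sub>\<infinity>n::int. exp (- pi * t * (x + of_int n)\<^sup>2))"
  define P where "P = (\<lambda>x. \<Sum>\<^sub>\<infinity>k. e k * cos (2 * pi * of_int k * x))"
  have e: "\<bar>e k\<bar> \<le> exp (- pi / t) ^ nat (\<bar>k\<bar> - 1)" for k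
    using gaussian_shift_bound[of "1 / t" 0 k] t by (simp add: e_def)
  have r: "0 \<le> exp (- pi / t)" "exp (- pi / t) < 1" using t by auto
  have "\<bar>e k * cos (2 * pi * of_int k * x)\<bar> \<le> exp (- pi / t) ^ nat (\<bar>k\<bar> - 1)" for k x
    using e[of k] by (intro order.trans[OF _ e[of k]]) (simp add: abs_mult mult_left_le)
  then have contP: "continuous_on {0..1} P"
    unfolding P_def by (intro unit_interval_series_continuous[OF r] continuous_intros) auto
  have contF: "continuous_on {0..1} F"
    unfolding F_def using t gaussian_shift_bound[OF t]
    by (intro unit_interval_series_continuous[of "exp (- pi * t)"] continuous_intros) auto
  have "F 0 - P 0 / sqrt t = 0"
  proof (rule continuous_even_orthogonal_cos_imp_zero[of "\<lambda>x. F x - P x / sqrt t"])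
    show "continuous_on {0..1} (\<lambda>x. F x - P x / sqrt t)"
      using t by (intro continuous_intros contF contP) auto
    show "F (1 - x) - P (1 - x) / sqrt t = F x - P x / sqrt t" for x
    proof -
      have "F (1 - x) = F x"
        unfolding F_def
        by (rule infsum_reindex_bij_witness[of _ "\<lambda>n. - 1 - n" "\<lambda>n. - 1 - n"])
           (auto simp: power2_eq_square algebra_simps)
      moreover have "cos (2 * pi * of_int k * (1 - x)) = cos (2 * pi * of_int k * x)" for k :: int
      proof -
        have "2 * pi * of_int k * (1 - x) = - (2 * pi * of_int k * x) + 2 * pi * of_int k"
          by (simp add: algebra_simps)
        then show ?thesis by (simp only: cos_add_int_2pi cos_minus)
      qed
      then have "P (1 - x) = P x" unfolding P_def by presburger
      ultimately show ?thesis by simp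
    qed
    show "integral {0..1} (\<lambda>x. (F x - P x / sqrt t) * cos (2 * pi * of_int j * x)) = 0" for j :: int
    proof -
      let ?c = "\<lambda>x. cos (2 * pi * of_int j * x)"
      have "integral {0..1} (\<lambda>x. (F x - P x / sqrt t) * ?c x) = integral {0..1} (\<lambda>x. F x * ?c x - 1 / sqrt t * (P x * ?c x))"
        by (simp add: algebra_simps)
      also have "\<dots> = integral {0..1} (\<lambda>x. F x * ?c x) - integral {0..1} (\<lambda>x. 1 / sqrt t * (P x * ?c x))"
        by (intro integral_diff integrable_continuous_real continuous_intros contF contP)
      also have "integral {0..1} (\<lambda>x. F x * ?c x) = e j / sqrt t"
        unfolding F_def e_def by (rule gaussian_fourier_coefficient[OF t])
      also have "integral {0..1} (\<lambda>x. 1 / sqrt t * (P x * ?c x)) = 1 / sqrt t * integral {0..1} (\<lambda>x. P x * ?c x)"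
        by (rule integral_mult_right)
      also have "integral {0..1} (\<lambda>x. P x * ?c x) = e j"
        unfolding P_def by (rule cos_series_coefficient[OF r e]) (simp add: e_def)
      finally show ?thesis by simp
    qed
  qed auto
  then show ?thesis by (simp add: F_def P_def e_def)
qed

section \<open>Transfer of the inversion to \<open>theta3\<close>\<close>

lemma theta3_exp_real:
  assumes "t > 0"
  shows "theta3 (of_real (exp (- pi * t))) = of_real (\<Sum>\<^sub>\<infinity>n::int. exp (- pi * t * (of_int n)\<^sup>2))"
proof -
  have *: "of_real (exp (- pi * t)) powi k\<^sup>2 = complex_of_real (exp (- pi * t * (of_int k)\<^sup>2))" for k :: int
  proof -
    have "exp (- pi * t) ^ nat (k\<^sup>2) = exp (- pi * t * (of_int k)\<^sup>2)"
      by (simp add: exp_of_nat_mult[symmetric] mult_ac)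
    then show ?thesis by (simp add: power_int_def flip: of_real_power)
  qed
  have "(\<lambda>k::int. exp (- pi * t * (of_int k)\<^sup>2)) summable_on UNIV"
    using theta3_abs_summable[of "of_real (exp (- pi * t))"] assms unfolding * by simp
  then have "((\<lambda>k::int. complex_of_real (exp (- pi * t * (of_int k)\<^sup>2))) has_sum of_real (\<Sum>\<^sub>\<infinity>n::int. exp (- pi * t * (of_int n)\<^sup>2))) UNIV"
    by (intro has_sum_of_real has_sum_infsum)
  then show ?thesis unfolding theta3_def * by (rule infsumI)
qed

lemma theta3_inversion:
  assumes t: "t > 0"
  shows "theta3 (of_real (exp (- pi / t))) = of_real (sqrt t) * theta3 (of_real (exp (- pi * t)))"
proof -
  have "theta3 (of_real (exp (- pi * (1 / t)))) = of_real (\<Sum>\<^sub>\<infinity>n::int. exp (- pi * (1 / t) * (of_int n)\<^sup>2))"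
    using t by (intro theta3_exp_real) auto
  moreover have "(\<Sum>\<^sub>\<infinity>n::int. exp (- pi * (1 / t) * (of_int n)\<^sup>2)) = sqrt t * (\<Sum>\<^sub>\<infinity>n::int. exp (- pi * t * (of_int n)\<^sup>2))"
    using gaussian_sum_inversion[OF t] t by simp
  ultimately show ?thesis using theta3_exp_real[OF t] by simp
qed

subsection \<open>Evaluation of the series\<close>

text \<open>Differentiate both sides of \<open>theta3_inversion\<close> with respect to the real
  variable t.\<close>

lemma theta3_inversion_deriv:
  fixes t :: real
  assumes t: "t > 0"
  defines "q1 \<equiv> complex_of_real (exp (- pi / t))" and "q2 \<equiv> complex_of_real (exp (- pi * t))"
  shows "of_real (pi / t\<^sup>2) * (q1 * deriv theta3 q1)
     = of_real (1 / (2 * sqrt t)) * theta3 q2 - of_real (pi * sqrt t) * (q2 * deriv theta3 q2)"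
proof -
  have n: "norm q1 < 1" "norm q2 < 1" using t by (auto simp: q1_def q2_def)
  have d: "(theta3 has_field_derivative deriv theta3 q) (at q)" if "norm q < 1" for q
    using that by (intro holomorphic_derivI[OF theta3_holomorphic]) auto
  have "((\<lambda>t. complex_of_real (exp (- pi / t))) has_vector_derivative of_real (exp (- pi / t) * (pi / t\<^sup>2))) (at t)"
    using t by (intro has_vector_derivative_of_real) (auto intro!: derivative_eq_intros simp: power2_eq_square)
  from field_vector_diff_chain_at[OF this d] n
  have 1: "((\<lambda>t. theta3 (of_real (exp (- pi / t)))) has_vector_derivative
      (of_real (exp (- pi / t) * (pi / t\<^sup>2)) * deriv theta3 q1)) (at t)"
    by (simp add: q1_def o_def)
  have "((\<lambda>t. complex_of_real (exp (- pi * t))) has_vector_derivative of_real (- pi * exp (- pi * t))) (at t)"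
    by (intro has_vector_derivative_of_real) (auto intro!: derivative_eq_intros)
  from field_vector_diff_chain_at[OF this d] n
  have 2: "((\<lambda>t. theta3 (of_real (exp (- pi * t)))) has_vector_derivative (of_real (- pi * exp (- pi * t)) * deriv theta3 q2)) (at t)"
    by (simp add: q2_def o_def)
  have "((\<lambda>t. complex_of_real (sqrt t)) has_vector_derivative of_real (1 / (2 * sqrt t))) (at t)"
    using t by (intro has_vector_derivative_of_real) (auto intro!: derivative_eq_intros simp: field_simps)
  from has_vector_derivative_mult[OF this 2]
  have 3: "((\<lambda>t. of_real (sqrt t) * theta3 (of_real (exp (- pi * t)))) has_vector_derivative
      of_real (sqrt t) * (of_real (- pi * exp (- pi * t)) * deriv theta3 q2) + of_real (1 / (2 * sqrt t)) * theta3 q2) (at t)"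
    by (simp add: q2_def)
  \<comment> \<open>The inversion formula holds on the open half-line of positive t, so the
    right-hand side also has the derivative of the left-hand side; uniqueness then equates it with
    the product rule.\<close>
  have "((\<lambda>t. of_real (sqrt t) * theta3 (of_real (exp (- pi * t)))) has_vector_derivative
      (of_real (exp (- pi / t) * (pi / t\<^sup>2)) * deriv theta3 q1)) (at t)"
    by (rule has_vector_derivative_transform_within_open[OF 1, of "{0<..}"])
       (use t theta3_inversion in auto)
  from vector_derivative_unique_at[OF this 3]
  show ?thesis by (simp add: q1_def q2_def algebra_simps)
qed

text \<open>The Nth power of the argument \<open>q1\<close> is q, so inversion at t = sqrt N and its
  derivative express all entries of the determinant by \<open>theta3\<close> and its derivative at
  q. The fifth power clears the remaining denominators.\<close>

lemma theta_D_eq: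
  fixes N :: nat
  assumes N: "N > 0"
  defines "q \<equiv> complex_of_real (exp (- pi * sqrt N))"
  assumes nz: "theta3 q \<noteq> 0"
  shows "theta_D N (of_real (exp (- pi / sqrt N))) * theta3 q ^ 5
    = 2 * of_real (sqrt N) * (q * deriv theta3 q) - theta3 q / (2 * of_real pi)"
proof -
  \<comment> \<open>The fourth root of N, in terms of which all powers of N that occur are integral
    powers.\<close>
  define g where "g = complex_of_real (sqrt (sqrt N))"
  define q1 where "q1 = complex_of_real (exp (- pi / sqrt N))"
  define \<theta> d d1 where "\<theta> = theta3 q" and "d = q * deriv theta3 q" and "d1 = q1 * deriv theta3 q1"
  have g2: "of_real (sqrt N) = g\<^sup>2" unfolding g_def by (simp flip: of_real_power)
  have g4: "of_nat N = g ^ 4"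
  proof -
    have "g ^ 4 = (g\<^sup>2)\<^sup>2" by simp
    also have "\<dots> = of_nat N" unfolding g2[symmetric] by (simp flip: of_real_power)
    finally show ?thesis by simp
  qed
  have g0: "g \<noteq> 0" using N by (simp add: g_def)
  have pi0: "complex_of_real pi \<noteq> 0" by simp
  have q1N: "q1 ^ N = q"
  proof -
    have "exp (- pi / sqrt N) ^ N = exp (- pi * sqrt N)"
    proof -
      have "real N * (- pi / sqrt N) = - pi * (real N / sqrt N)" by simp
      also have "real N / sqrt N = sqrt N" by (rule real_div_sqrt) simp
      finally show ?thesis by (simp only: exp_of_nat_mult[symmetric])
    qed
    then show ?thesis by (simp add: q1_def q_def flip: of_real_power)
  qed
  have nq: "norm q < 1" "q1 \<noteq> 0" using N by (auto simp: q_def q1_def)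
  have \<theta>1: "theta3 q1 = g * \<theta>"
    using theta3_inversion[of "sqrt N"] N by (simp add: q1_def q_def \<theta>_def g_def)
  have "of_real (pi / (sqrt N)\<^sup>2) * d1 = of_real (1 / (2 * sqrt (sqrt N))) * \<theta> - of_real (pi * sqrt (sqrt N)) * d"
    using theta3_inversion_deriv[of "sqrt N"] N by (simp add: q1_def q_def \<theta>_def d_def d1_def)
  then have "of_real pi / g ^ 4 * d1 = \<theta> / (2 * g) - of_real pi * g * d"
    by (simp add: g_def[symmetric] g4)
  then have d1: "d1 = g ^ 4 / of_real pi * (\<theta> / (2 * g) - of_real pi * g * d)"
    using g0 pi0 by (simp add: field_simps)
  have "((\<lambda>z. theta3 (z ^ N)) has_field_derivative deriv theta3 (q1 ^ N) * (of_nat N * q1 ^ (N - 1))) (at q1)"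
    using nq unfolding q1N[symmetric]
    by (intro DERIV_chain2[of theta3] holomorphic_derivI[OF theta3_holomorphic]) (auto intro!: derivative_eq_intros)
  then have "q1 * deriv (\<lambda>z. theta3 (z ^ N)) q1 = deriv theta3 (q1 ^ N) * (of_nat N * (q1 * q1 ^ (N - 1)))"
    by (simp add: DERIV_imp_deriv)
  also have "q1 * q1 ^ (N - 1) = q" using N by (simp add: q1N flip: power_Suc)
  finally have dN: "q1 * deriv (\<lambda>z. theta3 (z ^ N)) q1 = g ^ 4 * d"
    by (simp add: q1N d_def g4)
  have "theta_D N q1 = 1 / ((g * \<theta>) ^ 3 * \<theta> ^ 3) * (g * \<theta> * (g ^ 4 * d) - \<theta> * d1)"
    unfolding theta_D_def det_2 by (simp add: vector_2 dN \<theta>1 q1N) (simp add: \<theta>_def d1_def)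
  also have "\<dots> * \<theta> ^ 5 = 2 * g\<^sup>2 * d - \<theta> / (2 * of_real pi)"
    unfolding d1 using g0 pi0 nz unfolding \<theta>_def[symmetric]
    by (simp add: field_simps eval_nat_numeral)
  finally show ?thesis by (simp add: q1_def \<theta>_def d_def g2)
qed

lemma exp_minus_pi_sqrt_in_small_disc:
  assumes "N > (2::nat)"
  shows "complex_of_real (exp (- pi * sqrt N)) \<in> small_disc"
proof -
  \<comment> \<open>Since (17/10)^2 = 2.89 < 3, the product pi sqrt N exceeds 5.\<close>
  have "17 / 10 \<le> sqrt N" using assms by (intro real_le_rsqrt) (simp add: power2_eq_square)
  then have "3 * (17 / 10) \<le> pi * sqrt N" using pi_gt3 by (intro mult_mono) auto
  then have 1: "exp 5 \<le> exp (pi * sqrt N)" by simp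
  \<comment> \<open>The bound 13/8 is the quadratic Taylor polynomial 1 + x + x^2 / 2 of exp at x =
    1/2; its tenth power exceeds 100.\<close>
  have "(13 / 8) ^ 10 \<le> exp (1 / 2 :: real) ^ 10"
    using exp_lower_Taylor_quadratic[of "1 / 2"] by (intro power_mono) (auto simp: power2_eq_square)
  also have "\<dots> = exp 5" by (simp add: exp_of_nat_mult[symmetric])
  finally have "(100 :: real) < exp 5" by (simp add: eval_nat_numeral)
  with 1 have "100 < exp (pi * sqrt N)" by linarith
  then show ?thesis by (simp add: exp_minus field_simps norm_divide)
qed

theorem theorem1p1:
  fixes N :: nat and \<alpha>N :: complex
  assumes "N > 2"
    and "\<alpha>N = theta_alpha (of_real (exp (- pi * sqrt (real N))))"
  shows "(\<lambda>k. pochhammer (1 / 2) k ^ 3 / fact k ^ 3 *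
            (of_nat k * (1 - 2 * \<alpha>N)
              - 2 / of_real (sqrt (real N)) * theta_D N (of_real (exp (- pi / sqrt (real N))))) *
            (4 * \<alpha>N * (1 - \<alpha>N)) ^ k)
         sums (1 / (of_real (sqrt (real N)) * of_real pi))"
proof -
  define q s D where "q = complex_of_real (exp (- pi * sqrt N))" and "s = complex_of_real (sqrt N)"
    and "D = theta_D N (of_real (exp (- pi / sqrt N)))"
  define X \<theta> where "X = 4 * \<alpha>N * (1 - \<alpha>N)" and "\<theta> = theta3 q"
  have q: "q \<in> small_disc" using exp_minus_pi_sqrt_in_small_disc[OF assms(1)] by (simp add: q_def)
  have \<theta>: "\<theta> \<noteq> 0" using theta3_nonzero[OF q] by (simp add: \<theta>_def)
  have s: "s \<noteq> 0" using assms(1) by (simp add: s_def)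
  have \<alpha>: "\<alpha>N = theta_lam q"
    using assms(2) theta_alpha_eq_lam[of q] by (simp add: q_def)
  have H0: "clausen_series 0 X = \<theta> ^ 4"
    using theta3_power4_eq_clausen_series[OF q] by (simp add: X_def \<alpha> \<theta>_def)
  have H1: "(1 - 2 * \<alpha>N) * clausen_series 1 X * \<theta> = 4 * (q * deriv theta3 q)"
    using clausen_series_1_eq[OF q] by (simp add: X_def \<alpha> \<theta>_def)
  have D: "D * \<theta> ^ 5 = 2 * s * (q * deriv theta3 q) - \<theta> / (2 * of_real pi)"
    using theta_D_eq[of N] assms(1) \<theta> by (simp add: q_def s_def D_def \<theta>_def)
  have X: "norm X < 1" using clausen_argument_bound[OF q] by (simp add: X_def \<alpha>)
  have "(\<lambda>k. (1 - 2 * \<alpha>N) * (of_nat k ^ 1 * clausen_coeff k * X ^ k) - 2 / s * D * (of_nat k ^ 0 * clausen_coeff k * X ^ k))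
     sums ((1 - 2 * \<alpha>N) * clausen_series 1 X - 2 / s * D * clausen_series 0 X)"
    by (intro sums_diff sums_mult clausen_series_sums X)
  \<comment> \<open>After multiplication by \<open>\<theta>\<close>, the first part is four times
    the Euler derivative of \<open>theta3\<close>. The same quantity occurs in 2 / s times
    \<open>D * \<theta> ^ 5\<close>, so only the term with pi remains.\<close>
  moreover have "(1 - 2 * \<alpha>N) * clausen_series 1 X - 2 / s * D * clausen_series 0 X = 1 / (s * of_real pi)"
  proof -
    have "((1 - 2 * \<alpha>N) * clausen_series 1 X - 2 / s * D * clausen_series 0 X) * \<theta>
        = (1 - 2 * \<alpha>N) * clausen_series 1 X * \<theta> - 2 / s * (D * \<theta> ^ 5)"
      by (simp add: H0 left_diff_distrib eval_nat_numeral)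
    also have "\<dots> = 1 / (s * of_real pi) * \<theta>"
      unfolding H1 D using s by (simp add: field_simps)
    finally show ?thesis using \<theta> by (simp only: mult_cancel_right) simp
  qed
  moreover have "(1 - 2 * \<alpha>N) * (of_nat k ^ 1 * clausen_coeff k * X ^ k) - 2 / s * D * (of_nat k ^ 0 * clausen_coeff k * X ^ k)
      = pochhammer (1 / 2) k ^ 3 / fact k ^ 3 * (of_nat k * (1 - 2 * \<alpha>N) - 2 / s * D) * X ^ k" for k
    unfolding clausen_coeff_def[symmetric] by (simp add: algebra_simps)
  ultimately show ?thesis
    unfolding X_def[symmetric] s_def[symmetric] D_def[symmetric] by simp
qed

end
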